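(* Fix an integer $n\geq 1$. There is an effective (i.e. explicitly computable from $n$) universal constant $C(n)$, depending only on $n$, such that for an arbitrary (possibly infinite) set $S$ of polynomial maps $\mathbb{Z}^n\to\mathbb{Z}^n$ with integer coefficients, and any $S$-periodic point $x\in\mathbb{Z}^n$, we have $$|\mathcal{O}_S(x)|\leq C(n).$$ In particular, there is a polynomial-time algorithm to decide, given $x\in\mathbb{Z}^n$ and a finite set $S$ of polynomial endomorphisms of $\mathbb{Z}^n$ over $\mathbb{Z}$, whether or not $x$ is $S$-periodic.
   Context: Let $S$ be a collection of endomorphisms (self-maps) of a set $X$, and let $\langle S\rangle$ be the monoid under composition (including the identity) generated by $S$. For $x\in X$, the $S$-orbit of $x$ is $\mathcal{O}_S(x)=\{f(x): f\in\langle S\rangle\}$. The point $x$ is called $S$-periodic if $\mathcal{O}_S(x)$ is a finite set and $\langle S\rangle$ acts on $\mathcal{O}_S(x)$ by permutations (every $f\in\langle S\rangle$ restricts to a bijection of $\mathcal{O}_S(x)$ to itself). For example, if $S=\{f\}$, then $x$ is $S$-periodic if and only if $f^k(x)=x$ for some $k\geq 1$. A polynomial map $\mathbb{Z}^n\to\mathbb{Z}^n$ with integer coefficients is one of the form $a\mapsto(f_1(a),\dots,f_n(a))$ with $f_i\in\mathbb{Z}[x_1,\dots,x_n]$. For the algorithmic statement, $n$ is fixed, and "polynomial-time" is measured as follows: the total number of integer additions and multiplications performed is bounded by a polynomial function of the number of arithmetic operations appearing in the polynomials in $S$. *)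

theory Defs
  imports
    Complex_Main
    "HOL-Library.Poly_Mapping"
    "HOL-Computational_Algebra.Polynomial"
begin

section \<open>Orbits and periodic points of a set of self-maps\<close>

inductive_set generated_monoid :: "('a \<Rightarrow> 'a) set \<Rightarrow> ('a \<Rightarrow> 'a) set"
  for S :: "('a \<Rightarrow> 'a) set" where
  id: "id \<in> generated_monoid S"
| comp: "f \<in> S \<Longrightarrow> g \<in> generated_monoid S \<Longrightarrow> f \<circ> g \<in> generated_monoid S"

definition orbit :: "('a \<Rightarrow> 'a) set \<Rightarrow> 'a \<Rightarrow> 'a set" where
  "orbit S x = {f x | f. f \<in> generated_monoid S}"

definition periodic_point :: "('a \<Rightarrow> 'a) set \<Rightarrow> 'a \<Rightarrow> bool" where
  "periodic_point S x \<longleftrightarrow>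
     finite (orbit S x) \<and> (\<forall>f \<in> generated_monoid S. bij_betw f (orbit S x) (orbit S x))"


section \<open>Polynomial maps of \<open>\<int>\<^sup>n\<close>\<close>

text \<open>
  Points of \<open>\<int>\<^sup>n\<close> are integer lists of length \<open>n\<close>, since the bound \<open>C(n)\<close> has to be a function
  of a varying \<open>n\<close>. A polynomial over \<open>\<int>\<close> in the indeterminates \<open>x\<^sub>0, x\<^sub>1, \<dots>\<close> is a finitely
  supported function from monomials to coefficients, a monomial being a finitely supported
  function from indices to exponents; this type carries the polynomial ring structure.
\<close>

definition int_points :: "nat \<Rightarrow> int list set" where
  "int_points n = {a. length a = n}"

type_synonym int_mpoly = "(nat \<Rightarrow>\<^sub>0 nat) \<Rightarrow>\<^sub>0 int"

definition mpoly_vars :: "int_mpoly \<Rightarrow> nat set" where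
  "mpoly_vars p = (\<Union>m \<in> Poly_Mapping.keys p. Poly_Mapping.keys m)"

definition mpoly_eval :: "int list \<Rightarrow> int_mpoly \<Rightarrow> int" where
  "mpoly_eval a p = (\<Sum>m \<in> Poly_Mapping.keys p. Poly_Mapping.lookup p m *
     (\<Prod>i \<in> Poly_Mapping.keys m. (a ! i) ^ Poly_Mapping.lookup m i))"

text \<open>Only the values of \<open>F\<close> on \<open>\<int>\<^sup>n\<close> matter.\<close>

definition polynomial_map :: "nat \<Rightarrow> (int list \<Rightarrow> int list) \<Rightarrow> bool" where
  "polynomial_map n F \<longleftrightarrow>
     (\<exists>ps. length ps = n \<and> (\<forall>p \<in> set ps. mpoly_vars p \<subseteq> {..<n}) \<and>
        (\<forall>a \<in> int_points n. F a = map (mpoly_eval a) ps))"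


section \<open>Polynomials as arithmetic expressions\<close>

text \<open>
  The inputs of an algorithm are polynomials written with additions and multiplications;
  a power is a repeated product and \<open>p - q\<close> is \<open>p + (-1) * q\<close>.
\<close>

datatype pexp = PConst int | PVar nat | PAdd pexp pexp | PMul pexp pexp

fun pexp_vars :: "pexp \<Rightarrow> nat set" where
  "pexp_vars (PConst c) = {}"
| "pexp_vars (PVar i) = {i}"
| "pexp_vars (PAdd p q) = pexp_vars p \<union> pexp_vars q"
| "pexp_vars (PMul p q) = pexp_vars p \<union> pexp_vars q"

fun pexp_eval :: "int list \<Rightarrow> pexp \<Rightarrow> int" where
  "pexp_eval a (PConst c) = c"
| "pexp_eval a (PVar i) = a ! i"
| "pexp_eval a (PAdd p q) = pexp_eval a p + pexp_eval a q"
| "pexp_eval a (PMul p q) = pexp_eval a p * pexp_eval a q"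

fun pexp_ops :: "pexp \<Rightarrow> nat" where
  "pexp_ops (PConst c) = 0"
| "pexp_ops (PVar i) = 0"
| "pexp_ops (PAdd p q) = Suc (pexp_ops p + pexp_ops q)"
| "pexp_ops (PMul p q) = Suc (pexp_ops p + pexp_ops q)"

definition pexp_tuples :: "nat \<Rightarrow> pexp list set" where
  "pexp_tuples n = {es. length es = n \<and> (\<forall>e \<in> set es. pexp_vars e \<subseteq> {..<n})}"

definition pexp_map :: "pexp list \<Rightarrow> int list \<Rightarrow> int list" where
  "pexp_map es a = map (pexp_eval a) es"

definition total_ops :: "pexp list list \<Rightarrow> nat" where
  "total_ops fs = (\<Sum>es \<leftarrow> fs. \<Sum>e \<leftarrow> es. pexp_ops e)"


text \<open>Every tuple of expressions defines a polynomial map, and every polynomial map arises so.\<close>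

definition monom_eval :: "int list \<Rightarrow> (nat \<Rightarrow>\<^sub>0 nat) \<Rightarrow> int" where
  "monom_eval a m = (\<Prod>i \<in> Poly_Mapping.keys m. (a ! i) ^ Poly_Mapping.lookup m i)"

lemma monom_eval_superset:
  assumes "finite K" "Poly_Mapping.keys m \<subseteq> K"
  shows "monom_eval a m = (\<Prod>i \<in> K. (a ! i) ^ Poly_Mapping.lookup m i)"
  unfolding monom_eval_def
  by (rule prod.mono_neutral_left) (use assms in \<open>auto simp: in_keys_iff\<close>)

lemma monom_eval_add: "monom_eval a (m + m') = monom_eval a m * monom_eval a m'"
proof -
  let ?K = "Poly_Mapping.keys m \<union> Poly_Mapping.keys m'"
  have "monom_eval a (m + m') = (\<Prod>i \<in> ?K. (a ! i) ^ Poly_Mapping.lookup (m + m') i)"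
    by (rule monom_eval_superset) (use keys_add[of m m'] in auto)
  also have "\<dots> = (\<Prod>i \<in> ?K. (a ! i) ^ Poly_Mapping.lookup m i) * (\<Prod>i \<in> ?K. (a ! i) ^ Poly_Mapping.lookup m' i)"
    by (simp add: lookup_add power_add prod.distrib)
  also have "\<dots> = monom_eval a m * monom_eval a m'"
    by (simp add: monom_eval_superset[of ?K])
  finally show ?thesis .
qed

lemma mpoly_eval_superset:
  assumes "finite K" "Poly_Mapping.keys p \<subseteq> K"
  shows "mpoly_eval a p = (\<Sum>m \<in> K. Poly_Mapping.lookup p m * monom_eval a m)"
  unfolding mpoly_eval_def monom_eval_def
  by (rule sum.mono_neutral_left) (use assms in \<open>auto simp: in_keys_iff\<close>)

lemma mpoly_eval_zero: "mpoly_eval a 0 = 0"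
  by (simp add: mpoly_eval_def)

lemma mpoly_eval_single: "mpoly_eval a (Poly_Mapping.single m c) = c * monom_eval a m"
  by (simp add: mpoly_eval_def monom_eval_def)

lemma mpoly_eval_add: "mpoly_eval a (p + q) = mpoly_eval a p + mpoly_eval a q"
proof -
  let ?K = "Poly_Mapping.keys p \<union> Poly_Mapping.keys q"
  have "mpoly_eval a (p + q) = (\<Sum>m \<in> ?K. Poly_Mapping.lookup (p + q) m * monom_eval a m)"
    by (rule mpoly_eval_superset) (use keys_add[of p q] in auto)
  also have "\<dots> = (\<Sum>m \<in> ?K. Poly_Mapping.lookup p m * monom_eval a m) + (\<Sum>m \<in> ?K. Poly_Mapping.lookup q m * monom_eval a m)"
    by (simp add: lookup_add distrib_right sum.distrib)
  also have "\<dots> = mpoly_eval a p + mpoly_eval a q"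
    by (simp add: mpoly_eval_superset[of ?K])
  finally show ?thesis .
qed

lemma mpoly_eval_sum: "mpoly_eval a (sum f A) = (\<Sum>x \<in> A. mpoly_eval a (f x))"
  by (induction A rule: infinite_finite_induct) (simp_all add: mpoly_eval_zero mpoly_eval_add)

lemma mpoly_expansion: "p = (\<Sum>m \<in> Poly_Mapping.keys p. Poly_Mapping.single m (Poly_Mapping.lookup p m))"
  by (rule poly_mapping_eqI)
     (simp add: lookup_sum lookup_single when_def in_keys_iff sum.delta')

lemma mpoly_eval_mult: "mpoly_eval a (p * q) = mpoly_eval a p * mpoly_eval a q"
proof -
  have "p * q = (\<Sum>m \<in> Poly_Mapping.keys p. Poly_Mapping.single m (Poly_Mapping.lookup p m))
      * (\<Sum>m' \<in> Poly_Mapping.keys q. Poly_Mapping.single m' (Poly_Mapping.lookup q m'))"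
    using mpoly_expansion[of p] mpoly_expansion[of q] by (rule arg_cong2)
  also have "\<dots> = (\<Sum>m \<in> Poly_Mapping.keys p. \<Sum>m' \<in> Poly_Mapping.keys q.
      Poly_Mapping.single (m + m') (Poly_Mapping.lookup p m * Poly_Mapping.lookup q m'))"
    by (simp only: sum_product mult_single)
  finally have "mpoly_eval a (p * q) =
      (\<Sum>m \<in> Poly_Mapping.keys p. \<Sum>m' \<in> Poly_Mapping.keys q.
        Poly_Mapping.lookup p m * Poly_Mapping.lookup q m' * (monom_eval a m * monom_eval a m'))"
    by (simp only: mpoly_eval_sum mpoly_eval_single monom_eval_add)
  also have "\<dots> = (\<Sum>m \<in> Poly_Mapping.keys p. Poly_Mapping.lookup p m * monom_eval a m)
      * (\<Sum>m' \<in> Poly_Mapping.keys q. Poly_Mapping.lookup q m' * monom_eval a m')"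
    by (simp only: sum_product mult.assoc mult.left_commute)
  finally show ?thesis
    by (simp only: mpoly_eval_def monom_eval_def)
qed

lemma mpoly_vars_add: "mpoly_vars (p + q) \<subseteq> mpoly_vars p \<union> mpoly_vars q"
  using keys_add[of p q] by (auto simp: mpoly_vars_def)

lemma mpoly_vars_mult: "mpoly_vars (p * q) \<subseteq> mpoly_vars p \<union> mpoly_vars q"
proof
  fix i assume "i \<in> mpoly_vars (p * q)"
  then obtain m where m: "m \<in> Poly_Mapping.keys (p * q)" "i \<in> Poly_Mapping.keys m"
    by (auto simp: mpoly_vars_def)
  obtain m1 m2 where "m = m1 + m2" "m1 \<in> Poly_Mapping.keys p" "m2 \<in> Poly_Mapping.keys q"
    using m(1) keys_mult[of p q] by auto
  then show "i \<in> mpoly_vars p \<union> mpoly_vars q"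
    using m(2) keys_add[of m1 m2] by (auto simp: mpoly_vars_def)
qed

fun mpoly_of_pexp :: "pexp \<Rightarrow> int_mpoly" where
  "mpoly_of_pexp (PConst c) = Poly_Mapping.single 0 c"
| "mpoly_of_pexp (PVar i) = Poly_Mapping.single (Poly_Mapping.single i 1) 1"
| "mpoly_of_pexp (PAdd p q) = mpoly_of_pexp p + mpoly_of_pexp q"
| "mpoly_of_pexp (PMul p q) = mpoly_of_pexp p * mpoly_of_pexp q"

lemma mpoly_eval_mpoly_of_pexp: "mpoly_eval a (mpoly_of_pexp e) = pexp_eval a e"
  by (induction e)
     (simp_all add: mpoly_eval_single monom_eval_def mpoly_eval_add mpoly_eval_mult)

lemma mpoly_vars_mpoly_of_pexp: "mpoly_vars (mpoly_of_pexp e) \<subseteq> pexp_vars e"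
proof (induction e)
  case (PAdd p q)
  then show ?case using mpoly_vars_add[of "mpoly_of_pexp p" "mpoly_of_pexp q"] by auto
next
  case (PMul p q)
  then show ?case using mpoly_vars_mult[of "mpoly_of_pexp p" "mpoly_of_pexp q"] by auto
qed (simp_all add: mpoly_vars_def)

lemma polynomial_map_pexp_map:
  assumes "es \<in> pexp_tuples n"
  shows "polynomial_map n (pexp_map es)"
  unfolding polynomial_map_def
proof (intro exI[of _ "map mpoly_of_pexp es"] conjI ballI)
  show "length (map mpoly_of_pexp es) = n"
    using assms by (simp add: pexp_tuples_def)
  show "mpoly_vars p \<subseteq> {..<n}" if "p \<in> set (map mpoly_of_pexp es)" for p
    using that assms mpoly_vars_mpoly_of_pexp by (fastforce simp: pexp_tuples_def)
  show "pexp_map es a = map (mpoly_eval a) (map mpoly_of_pexp es)" for a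
    by (simp add: pexp_map_def mpoly_eval_mpoly_of_pexp)
qed

lemma pexp_power:
  "\<exists>e. pexp_vars e \<subseteq> {i} \<and> (\<forall>a. pexp_eval a e = (a ! i) ^ k)"
proof (induction k)
  case 0
  show ?case by (rule exI[of _ "PConst 1"]) simp
next
  case (Suc k)
  then obtain e where "pexp_vars e \<subseteq> {i}" "\<forall>a. pexp_eval a e = (a ! i) ^ k" by blast
  then show ?case by (intro exI[of _ "PMul (PVar i) e"]) simp
qed

lemma pexp_prod:
  assumes "finite I" "I \<subseteq> V"
  shows "\<exists>e. pexp_vars e \<subseteq> V \<and> (\<forall>a. pexp_eval a e = (\<Prod>i \<in> I. (a ! i) ^ k i))"
  using assms
proof (induction I rule: finite_induct)
  case empty
  show ?case by (rule exI[of _ "PConst 1"]) simp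
next
  case (insert i I)
  then obtain e where e: "pexp_vars e \<subseteq> V" "\<forall>a. pexp_eval a e = (\<Prod>i \<in> I. (a ! i) ^ k i)"
    by auto
  obtain e' where e': "pexp_vars e' \<subseteq> {i}" "\<forall>a. pexp_eval a e' = (a ! i) ^ k i"
    using pexp_power by blast
  show ?case
    by (rule exI[of _ "PMul e' e"]) (use insert e e' in auto)
qed

lemma pexp_sum:
  assumes "finite M" "\<And>m. m \<in> M \<Longrightarrow> Poly_Mapping.keys m \<subseteq> V"
  shows "\<exists>e. pexp_vars e \<subseteq> V \<and> (\<forall>a. pexp_eval a e = (\<Sum>m \<in> M. c m * monom_eval a m))"
  using assms
proof (induction M rule: finite_induct)
  case empty
  show ?case by (rule exI[of _ "PConst 0"]) simp
next
  case (insert m M)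
  then obtain e where e: "pexp_vars e \<subseteq> V" "\<forall>a. pexp_eval a e = (\<Sum>m \<in> M. c m * monom_eval a m)"
    by auto
  obtain e' where e': "pexp_vars e' \<subseteq> V" "\<forall>a. pexp_eval a e' = monom_eval a m"
    using pexp_prod[of "Poly_Mapping.keys m" V "Poly_Mapping.lookup m"] insert.prems by (auto simp: monom_eval_def)
  show ?case
    by (rule exI[of _ "PAdd (PMul (PConst (c m)) e') e"]) (use insert e e' in auto)
qed

lemma mpoly_pexp: "\<exists>e. pexp_vars e \<subseteq> mpoly_vars p \<and> (\<forall>a. pexp_eval a e = mpoly_eval a p)"
  using pexp_sum[of "Poly_Mapping.keys p" "mpoly_vars p" "Poly_Mapping.lookup p"]
  by (auto simp: mpoly_eval_def monom_eval_def mpoly_vars_def)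

lemma polynomial_map_iff_pexp_map:
  "polynomial_map n F \<longleftrightarrow> (\<exists>es \<in> pexp_tuples n. \<forall>a \<in> int_points n. F a = pexp_map es a)"
proof
  assume "polynomial_map n F"
  then obtain ps where ps: "length ps = n" "\<forall>p \<in> set ps. mpoly_vars p \<subseteq> {..<n}"
      "\<forall>a \<in> int_points n. F a = map (mpoly_eval a) ps"
    by (auto simp: polynomial_map_def)
  obtain g where g: "\<And>p. pexp_vars (g p) \<subseteq> mpoly_vars p"
      "\<And>p a. pexp_eval a (g p) = mpoly_eval a p"
    using mpoly_pexp by metis
  have "map g ps \<in> pexp_tuples n"
    using ps g(1) by (fastforce simp: pexp_tuples_def)
  moreover have "\<forall>a \<in> int_points n. F a = pexp_map (map g ps) a"
    using ps(3) g(2) by (simp add: pexp_map_def)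
  ultimately show "\<exists>es \<in> pexp_tuples n. \<forall>a \<in> int_points n. F a = pexp_map es a" by blast
next
  assume "\<exists>es \<in> pexp_tuples n. \<forall>a \<in> int_points n. F a = pexp_map es a"
  then show "polynomial_map n F"
    using polynomial_map_pexp_map by (fastforce simp: polynomial_map_def)
qed


section \<open>A model of computation\<close>

text \<open>
  While programs over binary trees whose leaves are \<open>Empty\<close> or arbitrary integers. Tree
  operations and comparisons are pure bookkeeping; new integers arise only from literals, of which
  a program contains finitely many, and from additions and multiplications, which are counted.
  Operations applied to arguments of the wrong shape return \<open>Empty\<close>.
\<close>

datatype val = Empty | IntV int | Pair val val

datatype expr =
    Var nat
  | Lit int
  | EmptyE
  | PairE expr expr
  | Fst expr
  | Snd expr
  | Plus expr expr
  | Times expr expr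

type_synonym store = "nat \<Rightarrow> val"

fun val_fst :: "val \<Rightarrow> val" where
  "val_fst (Pair u v) = u"
| "val_fst _ = Empty"

fun val_snd :: "val \<Rightarrow> val" where
  "val_snd (Pair u v) = v"
| "val_snd _ = Empty"

fun int_op :: "(int \<Rightarrow> int \<Rightarrow> int) \<Rightarrow> val \<Rightarrow> val \<Rightarrow> val" where
  "int_op f (IntV a) (IntV b) = IntV (f a b)"
| "int_op f _ _ = Empty"

fun expr_val :: "expr \<Rightarrow> store \<Rightarrow> val" where
  "expr_val (Var v) s = s v"
| "expr_val (Lit c) s = IntV c"
| "expr_val EmptyE s = Empty"
| "expr_val (PairE e e') s = Pair (expr_val e s) (expr_val e' s)"
| "expr_val (Fst e) s = val_fst (expr_val e s)"
| "expr_val (Snd e) s = val_snd (expr_val e s)"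
| "expr_val (Plus e e') s = int_op (+) (expr_val e s) (expr_val e' s)"
| "expr_val (Times e e') s = int_op (*) (expr_val e s) (expr_val e' s)"

fun expr_cost :: "expr \<Rightarrow> nat" where
  "expr_cost (Var v) = 0"
| "expr_cost (Lit c) = 0"
| "expr_cost EmptyE = 0"
| "expr_cost (PairE e e') = expr_cost e + expr_cost e'"
| "expr_cost (Fst e) = expr_cost e"
| "expr_cost (Snd e) = expr_cost e"
| "expr_cost (Plus e e') = Suc (expr_cost e + expr_cost e')"
| "expr_cost (Times e e') = Suc (expr_cost e + expr_cost e')"

datatype test =
    IsPair expr
  | IsInt expr
  | EqInt expr expr
  | LessInt expr expr

fun int_rel :: "(int \<Rightarrow> int \<Rightarrow> bool) \<Rightarrow> val \<Rightarrow> val \<Rightarrow> bool" where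
  "int_rel r (IntV a) (IntV b) = r a b"
| "int_rel r _ _ = False"

fun test_val :: "test \<Rightarrow> store \<Rightarrow> bool" where
  "test_val (IsPair e) s = (\<exists>u v. expr_val e s = Pair u v)"
| "test_val (IsInt e) s = (\<exists>a. expr_val e s = IntV a)"
| "test_val (EqInt e e') s = int_rel (=) (expr_val e s) (expr_val e' s)"
| "test_val (LessInt e e') s = int_rel (<) (expr_val e s) (expr_val e' s)"

fun test_cost :: "test \<Rightarrow> nat" where
  "test_cost (IsPair e) = expr_cost e"
| "test_cost (IsInt e) = expr_cost e"
| "test_cost (EqInt e e') = expr_cost e + expr_cost e'"
| "test_cost (LessInt e e') = expr_cost e + expr_cost e'"

datatype prog =
    Skip
  | Assign nat expr
  | Seq prog prog
  | If test prog prog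
  | While test prog

text \<open>
  \<open>runs c s k t\<close>: started in store \<open>s\<close>, the program \<open>c\<close> halts in store \<open>t\<close> after having performed
  exactly \<open>k\<close> additions and multiplications.
\<close>

inductive runs :: "prog \<Rightarrow> store \<Rightarrow> nat \<Rightarrow> store \<Rightarrow> bool" where
  Skip: "runs Skip s 0 s"
| Assign: "runs (Assign v e) s (expr_cost e) (s(v := expr_val e s))"
| Seq: "runs c s k t \<Longrightarrow> runs c' t k' u \<Longrightarrow> runs (Seq c c') s (k + k') u"
| IfTrue: "test_val b s \<Longrightarrow> runs c s k t \<Longrightarrow> runs (If b c c') s (test_cost b + k) t"
| IfFalse: "\<not> test_val b s \<Longrightarrow> runs c' s k t \<Longrightarrow> runs (If b c c') s (test_cost b + k) t"
| WhileFalse: "\<not> test_val b s \<Longrightarrow> runs (While b c) s (test_cost b) s"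
| WhileTrue: "test_val b s \<Longrightarrow> runs c s k t \<Longrightarrow> runs (While b c) t k' u \<Longrightarrow>
    runs (While b c) s (test_cost b + k + k') u"

lemma runs_deterministic: "runs c s k t \<Longrightarrow> runs c s k' t' \<Longrightarrow> k' = k \<and> t' = t"
proof (induction arbitrary: k' t' rule: runs.induct)
  case (Skip s)
  then show ?case by cases auto
next
  case (Assign v e s)
  then show ?case by cases auto
next
  case (Seq c s k t c' l u)
  from Seq.prems obtain k1 t1 k2
    where r: "k' = k1 + k2" "runs c s k1 t1" "runs c' t1 k2 t'" by cases
  have "k1 = k \<and> t1 = t" by (rule Seq.IH(1)[OF r(2)])
  moreover from this r(3) have "k2 = l \<and> t' = u" by (intro Seq.IH(2)) simp
  ultimately show ?case using r(1) by simp
next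
  case (IfTrue b s c k t c')
  from IfTrue.prems obtain k1 where r: "k' = test_cost b + k1" "runs c s k1 t'"
    by cases (use IfTrue.hyps in simp_all)
  show ?case using IfTrue.IH[OF r(2)] r(1) by simp
next
  case (IfFalse b s c' k t c)
  from IfFalse.prems obtain k1 where r: "k' = test_cost b + k1" "runs c' s k1 t'"
    by cases (use IfFalse.hyps in simp_all)
  show ?case using IfFalse.IH[OF r(2)] r(1) by simp
next
  case (WhileFalse b s c)
  from WhileFalse.prems show ?case by cases (use WhileFalse.hyps in simp_all)
next
  case (WhileTrue b s c k t l u)
  from WhileTrue.prems obtain k1 t1 k2
    where r: "k' = test_cost b + k1 + k2" "runs c s k1 t1" "runs (While b c) t1 k2 t'"
    by cases (use WhileTrue.hyps in simp_all)
  have "k1 = k \<and> t1 = t" by (rule WhileTrue.IH(1)[OF r(2)])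
  moreover from this r(3) have "k2 = l \<and> t' = u" by (intro WhileTrue.IH(2)) simp
  ultimately show ?case using r(1) by simp
qed

text \<open>The input is placed in variable \<open>0\<close>, all others being empty; the output is left there.\<close>

definition computes :: "prog \<Rightarrow> val \<Rightarrow> nat \<Rightarrow> val \<Rightarrow> bool" where
  "computes c v k w \<longleftrightarrow> (\<exists>t. runs c ((\<lambda>_. Empty)(0 := v)) k t \<and> t 0 = w)"

definition effective :: "(nat \<Rightarrow> nat) \<Rightarrow> bool" where
  "effective C \<longleftrightarrow> (\<exists>c. \<forall>n. \<exists>k. computes c (IntV (int n)) k (IntV (int (C n))))"

fun encode_list :: "val list \<Rightarrow> val" where
  "encode_list [] = Empty"
| "encode_list (v # vs) = Pair v (encode_list vs)"

fun encode_pexp :: "pexp \<Rightarrow> val" where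
  "encode_pexp (PConst c) = Pair (IntV 0) (IntV c)"
| "encode_pexp (PVar i) = Pair (IntV 1) (IntV (int i))"
| "encode_pexp (PAdd p q) = Pair (IntV 2) (Pair (encode_pexp p) (encode_pexp q))"
| "encode_pexp (PMul p q) = Pair (IntV 3) (Pair (encode_pexp p) (encode_pexp q))"

definition encode_point :: "int list \<Rightarrow> val" where
  "encode_point a = encode_list (map IntV a)"

definition encode_instance :: "int list \<Rightarrow> pexp list list \<Rightarrow> val" where
  "encode_instance a fs =
     Pair (encode_point a) (encode_list (map (\<lambda>es. encode_list (map encode_pexp es)) fs))"

definition decides_periodicity :: "nat \<Rightarrow> prog \<Rightarrow> (nat \<Rightarrow> nat) \<Rightarrow> bool" where
  "decides_periodicity n c T \<longleftrightarrow>
     (\<forall>x \<in> int_points n. \<forall>fs \<in> lists (pexp_tuples n).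
        \<exists>k \<le> T (total_ops fs).
          computes c (encode_instance x fs) k
            (IntV (if periodic_point (pexp_map ` set fs) x then 1 else 0)))"

end

theory Submission
  imports Defs "HOL-Library.FuncSet"
begin

text \<open>
  Let \<open>x\<close> be periodic for \<open>S\<close> with orbit \<open>O\<close>, and let \<open>M\<close> be the generated monoid. Since \<open>O\<close> is
  finite and \<open>M\<close> permutes it, every \<open>g \<in> M\<close> has an inverse on \<open>O\<close> that is again in \<open>M\<close>, namely a power
  of \<open>g\<close>. The bound \<open>9\<^bsup>n(n+1)\<^esup>\<close> comes from the following claim: the point \<open>f x\<close>, for \<open>f \<in> M\<close>, is
  determined by the residues modulo \<open>9\<close> of the values of \<open>f\<close> at the \<open>n + 1\<close> points \<open>x\<close> and \<open>x + 3 e\<^sub>j\<close>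
  (\<open>equal_jets_imp_equal_values\<close>); in other words, by \<open>f x\<close> modulo \<open>9\<close> and the Jacobian of \<open>f\<close> at \<open>x\<close>
  modulo \<open>3\<close>.

  To see this, let \<open>f\<close> and \<open>g\<close> have the same residues, let \<open>g'\<close> invert \<open>g\<close> on \<open>O\<close>, and put
  \<open>T = id + g' \<circ> f - g' \<circ> g\<close>. On \<open>O\<close> this polynomial map is the permutation \<open>g' \<circ> f\<close>, so \<open>x\<close> is a
  periodic point of \<open>T\<close>. By Taylor expansion the hypothesis on the residues gives
  \<open>T (x + 3 y) = x + 3 F y\<close>, where \<open>F\<close> is a polynomial map all of whose coefficients agree with those
  of the identity modulo \<open>3\<close>. A \<open>3\<close>-adic argument shows that a periodic point of such an \<open>F\<close> is fixed
  (\<open>perturb_periodic_is_fixed\<close>). Hence \<open>T x = x\<close>, that is \<open>g' (f x) = x = g' (g x)\<close>, and \<open>f x = g x\<close>.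
  Passing from \<open>g' \<circ> f\<close> to \<open>T\<close> is what makes the congruence with the identity hold: the Jacobian of
  \<open>g' \<circ> g\<close> may well be singular modulo \<open>3\<close>, because \<open>g' \<circ> g\<close> is the identity on \<open>O\<close> only.

  For the algorithm, let \<open>N\<close> be the bound. Starting with the list \<open>[x]\<close>, repeat \<open>N\<close> times: compute all
  images of the listed points and append one that is new, if there is one. At the end the list is
  either closed under all the maps, hence the whole orbit, or consists of \<open>N + 1\<close> points of the orbit,
  and then \<open>x\<close> is not periodic. So \<open>x\<close> is periodic if and only if each map sends the set of listed points
  onto itself. Rounds are counted in unary and points are compared coordinate by coordinate, so
  arithmetic is spent only in evaluating the given expressions, each at no more than \<open>(N + 1)\<^sup>2\<close> points:
  the number of operations is at most \<open>(N + 1)\<^sup>2\<close> times the number in the input.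

  Programs are never written down as a whole. The predicate \<open>transforms\<close> says that some program turns
  one encoded value into another at a given cost, and rules for sequencing, pairing, branching and
  folding over lists build the decision procedure as one builds a functional program.
\<close>

section \<open>Polynomial functions with integer coefficients\<close>

text \<open>
  Points are functions on the indices here, so that substitution is plain composition; polynomials in
  \<open>n\<close> variables read only the first \<open>n\<close> coordinates (\<open>int_poly_funs_agree\<close>).
\<close>

inductive_set int_poly_funs :: "nat \<Rightarrow> ((nat \<Rightarrow> int) \<Rightarrow> int) set" for n where
  const: "(\<lambda>_. c) \<in> int_poly_funs n"
| var: "i < n \<Longrightarrow> (\<lambda>y. y i) \<in> int_poly_funs n"
| add: "p \<in> int_poly_funs n \<Longrightarrow> q \<in> int_poly_funs n \<Longrightarrow> (\<lambda>y. p y + q y) \<in> int_poly_funs n"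
| mult: "p \<in> int_poly_funs n \<Longrightarrow> q \<in> int_poly_funs n \<Longrightarrow> (\<lambda>y. p y * q y) \<in> int_poly_funs n"

lemma int_poly_funs_sum:
  assumes "finite J" "\<And>j. j \<in> J \<Longrightarrow> p j \<in> int_poly_funs n"
  shows "(\<lambda>y. \<Sum>j\<in>J. p j y) \<in> int_poly_funs n"
  using assms
  by (induction J rule: finite_induct) (auto intro: int_poly_funs.intros)

lemma int_poly_funs_cmult: "p \<in> int_poly_funs n \<Longrightarrow> (\<lambda>y. c * p y) \<in> int_poly_funs n"
  by (rule int_poly_funs.mult[OF int_poly_funs.const])

lemma int_poly_funs_diff:
  assumes "p \<in> int_poly_funs n" "q \<in> int_poly_funs n"
  shows "(\<lambda>y. p y - q y) \<in> int_poly_funs n"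
  using int_poly_funs.add[OF assms(1) int_poly_funs_cmult[OF assms(2), of "-1"]] by simp

lemma int_poly_funs_linear: "(\<lambda>y. \<Sum>j<n. c j * y j) \<in> int_poly_funs n"
  by (rule int_poly_funs_sum) (auto intro: int_poly_funs_cmult int_poly_funs.var)

lemma int_poly_funs_compose:
  assumes "p \<in> int_poly_funs n" "\<And>i. i < n \<Longrightarrow> q i \<in> int_poly_funs m"
  shows "(\<lambda>y. p (\<lambda>i. q i y)) \<in> int_poly_funs m"
  using assms by (induction rule: int_poly_funs.induct) (auto intro: int_poly_funs.intros)

lemma int_poly_funs_agree:
  assumes "p \<in> int_poly_funs n" "\<And>i. i < n \<Longrightarrow> x i = y i"
  shows "p x = p y"
  using assms by (induction rule: int_poly_funs.induct) auto

text \<open>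
  The remainder \<open>R\<close> is again an integer polynomial because the coefficients of the expansion of
  \<open>p (x + m y)\<close> in the monomials in \<open>y\<close> of degree \<open>d\<close> are divisible by \<open>m\<^sup>d\<close>. It is this, and not only
  the congruence of values, that allows one to divide by \<open>m\<close> and stay within integer polynomials.
\<close>

lemma int_poly_funs_taylor:
  assumes "p \<in> int_poly_funs n"
  shows "\<exists>c. \<exists>R \<in> int_poly_funs n. \<forall>y.
           p (\<lambda>i. x i + m * y i) = p x + m * (\<Sum>j<n. c j * y j) + m\<^sup>2 * R y"
  using assms
proof (induction rule: int_poly_funs.induct)
  case (const c)
  show ?case
    by (intro exI[of _ "\<lambda>_. 0"] bexI[of _ "\<lambda>_. 0"]) (auto intro: int_poly_funs.const)
next
  case (var i)
  have "(\<Sum>j<n. (if j = i then 1 else 0) * y j) = y i" for y :: "nat \<Rightarrow> int"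
    using var by (subst sum.cong[OF refl, of _ _ "\<lambda>j. if j = i then y j else 0"]) auto
  then show ?case
    by (intro exI[of _ "\<lambda>j. if j = i then 1 else 0"] bexI[of _ "\<lambda>_. 0"])
       (auto intro: int_poly_funs.const)
next
  case (add p q)
  then obtain c R c' R' where R: "R \<in> int_poly_funs n" "R' \<in> int_poly_funs n"
    and eq: "\<And>y. p (\<lambda>i. x i + m * y i) = p x + m * (\<Sum>j<n. c j * y j) + m\<^sup>2 * R y"
      "\<And>y. q (\<lambda>i. x i + m * y i) = q x + m * (\<Sum>j<n. c' j * y j) + m\<^sup>2 * R' y"
    by blast
  show ?case
    by (intro exI[of _ "\<lambda>j. c j + c' j"] bexI[of _ "\<lambda>y. R y + R' y"])
       (use R in \<open>auto simp: eq algebra_simps sum.distrib intro: int_poly_funs.add\<close>)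
next
  case (mult p q)
  then obtain c R c' R' where R: "R \<in> int_poly_funs n" "R' \<in> int_poly_funs n"
    and eq: "\<And>y. p (\<lambda>i. x i + m * y i) = p x + m * (\<Sum>j<n. c j * y j) + m\<^sup>2 * R y"
      "\<And>y. q (\<lambda>i. x i + m * y i) = q x + m * (\<Sum>j<n. c' j * y j) + m\<^sup>2 * R' y"
    by blast
  let ?L = "\<lambda>y. \<Sum>j<n. c j * y j" and ?L' = "\<lambda>y. \<Sum>j<n. c' j * y j"
  let ?T = "\<lambda>y. ((p x * R' y + q x * R y) + ?L y * ?L' y)
      + (m * (?L y * R' y + ?L' y * R y) + m\<^sup>2 * (R y * R' y))"
  have lin: "(\<Sum>j<n. (p x * c' j + q x * c j) * y j) = p x * ?L' y + q x * ?L y" for y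
    by (simp add: algebra_simps sum.distrib sum_distrib_left)
  have T: "?T \<in> int_poly_funs n"
    by (intro int_poly_funs.add int_poly_funs.mult int_poly_funs_cmult int_poly_funs_linear R)
  show ?case
    by (intro exI[of _ "\<lambda>j. p x * c' j + q x * c j"] bexI[OF _ T])
       (simp add: eq lin, simp add: algebra_simps power2_eq_square)
qed

lemma int_poly_funs_cong:
  assumes "p \<in> int_poly_funs n" "\<And>i. i < n \<Longrightarrow> m dvd y i - x i"
  shows "m dvd p y - p x"
  using assms
proof (induction rule: int_poly_funs.induct)
  case (add p q)
  then have "m dvd (p y - p x) + (q y - q x)" by (intro dvd_add) auto
  then show ?case by (simp add: algebra_simps)
next
  case (mult p q)
  then have "m dvd (p y - p x) * q y + p x * (q y - q x)" by (intro dvd_add) auto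
  then show ?case by (simp add: algebra_simps)
qed auto

text \<open>
  The linear terms of the two Taylor expansions cancel.
\<close>

lemma int_poly_funs_second_difference:
  assumes "p \<in> int_poly_funs n" "\<And>i. m dvd d i"
  shows "m\<^sup>2 dvd p (\<lambda>i. x i + d i) + p (\<lambda>i. x i - d i) - 2 * p x"
proof -
  obtain z where z: "\<And>i. d i = m * z i" using assms(2) unfolding dvd_def by metis
  obtain c R where eq: "\<And>y. p (\<lambda>i. x i + m * y i) = p x + m * (\<Sum>j<n. c j * y j) + m\<^sup>2 * R y"
    using int_poly_funs_taylor[OF assms(1)] by blast
  have "p (\<lambda>i. x i + d i) + p (\<lambda>i. x i - d i) - 2 * p x = m\<^sup>2 * (R z + R (\<lambda>i. - z i))"
    using eq[of z] eq[of "\<lambda>i. - z i"] by (simp add: z algebra_simps sum_negf)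
  then show ?thesis by simp
qed

section \<open>Periodic points of maps congruent to the identity modulo 3\<close>

text \<open>
  Let \<open>F y = y + 3 h(y)\<close> with \<open>h\<close> an integer polynomial map. Suppose that \<open>y\<close> is periodic and that some
  multiple \<open>m\<close> of \<open>3\<close> divides the displacement \<open>F y - y = 3 h(y)\<close>. The displacements along the cycle of
  \<open>y\<close> sum to zero and are nearly equal; this forces \<open>3 m\<close> to divide the displacement. Beginning with
  \<open>m = 3\<close>, one finds that all powers of \<open>3\<close> divide it, so it vanishes.
\<close>

definition perturb :: "(nat \<Rightarrow> (nat \<Rightarrow> int) \<Rightarrow> int) \<Rightarrow> (nat \<Rightarrow> int) \<Rightarrow> nat \<Rightarrow> int" where
  "perturb h y = (\<lambda>i. y i + 3 * h i y)"

text \<open>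
  Iterates are of the same form, so that the period may be reduced one prime factor at a time.
\<close>

lemma perturb_funpow:
  assumes "\<And>i. h i \<in> int_poly_funs n"
  shows "\<exists>g. (\<forall>i. g i \<in> int_poly_funs n) \<and> perturb h ^^ k = perturb g"
proof (induction k)
  case 0
  show ?case
    by (rule exI[of _ "\<lambda>_ _. 0"]) (auto simp: perturb_def intro: int_poly_funs.const)
next
  case (Suc k)
  then obtain g where g: "\<forall>i. g i \<in> int_poly_funs n" "perturb h ^^ k = perturb g" by blast
  let ?q = "\<lambda>i y. h i (\<lambda>j. y j + 3 * g j y)"
  have "(\<lambda>y. y i + 3 * g i y) \<in> int_poly_funs n" if "i < n" for i
    using g that by (intro int_poly_funs.add int_poly_funs_cmult int_poly_funs.var) auto
  then have "?q i \<in> int_poly_funs n" for i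
    by (intro int_poly_funs_compose[OF assms])
  then have "\<forall>i. (\<lambda>y. g i y + ?q i y) \<in> int_poly_funs n"
    using g by (intro allI int_poly_funs.add) auto
  moreover have "perturb h ^^ Suc k = perturb (\<lambda>i y. g i y + ?q i y)"
    by (simp add: g(2) o_def) (simp add: perturb_def fun_eq_iff algebra_simps)
  ultimately show ?case by (intro exI[of _ "\<lambda>i y. g i y + ?q i y"] conjI)
qed

lemma zero_if_dvd_powers:
  fixes a :: int
  assumes "\<And>e. 3 ^ e dvd a"
  shows "a = 0"
proof (rule ccontr)
  assume "a \<noteq> 0"
  then have "3 ^ nat \<bar>a\<bar> \<le> \<bar>a\<bar>"
    using assms dvd_imp_le_int by (metis abs_numeral power_abs)
  moreover have "int (nat \<bar>a\<bar>) < 3 ^ nat \<bar>a\<bar>"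
    using of_nat_less_two_power[of "nat \<bar>a\<bar>", where 'a = int] power_mono[of "2::int" 3 "nat \<bar>a\<bar>"] by linarith
  ultimately show False by simp
qed

lemma perturb_fixed_if_improves:
  assumes "\<And>m. (3::int) dvd m \<Longrightarrow> \<forall>i. m dvd 3 * h i y \<Longrightarrow> \<forall>i. 3 * m dvd 3 * h i y"
  shows "perturb h y = y"
proof -
  have "\<forall>i. 3 ^ Suc e dvd 3 * h i y" for e
  proof (induction e)
    case 0
    show ?case by simp
  next
    case (Suc e)
    show ?case using assms[OF _ Suc] by simp
  qed
  then have "3 * h i y = 0" for i
    by (intro zero_if_dvd_powers) (metis dvd_trans le_imp_power_dvd le_add2 plus_1_eq_Suc)
  then show ?thesis by (simp add: perturb_def fun_eq_iff)
qed

text \<open>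
  All points \<open>z\<^sub>j\<close> of the cycle are congruent to \<open>y\<close> modulo \<open>m\<close>, hence so are the values \<open>h(z\<^sub>j)\<close> to
  \<open>h(y)\<close>. As the values sum to zero over the cycle, \<open>m\<close> divides \<open>k h(y)\<close>. It also divides \<open>3 h(y)\<close>,
  and \<open>k\<close> is prime to \<open>3\<close>.
\<close>

lemma perturb_periodic_coprime:
  assumes h: "\<And>i. h i \<in> int_poly_funs n" and per: "(perturb h ^^ k) y = y" and k: "\<not> 3 dvd k"
  shows "perturb h y = y"
proof (rule perturb_fixed_if_improves)
  fix m :: int assume m: "3 dvd m" "\<forall>i. m dvd 3 * h i y"
  define z where "z j = (perturb h ^^ j) y" for j
  have z: "z 0 = y" "\<And>j. z (Suc j) = (\<lambda>i. z j i + 3 * h i (z j))" "z k = y"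
    using per by (auto simp: z_def perturb_def)
  have cong: "m dvd z j i - y i" for i j
  proof (induction j arbitrary: i)
    case 0
    show ?case by (simp add: z)
  next
    case (Suc j)
    have "m dvd h i (z j) - h i y" using Suc by (intro int_poly_funs_cong[OF h])
    then have "m dvd (z j i - y i) + 3 * (h i (z j) - h i y) + 3 * h i y"
      using Suc m(2) by (simp only: dvd_add dvd_mult)
    then show ?case by (simp add: z algebra_simps)
  qed
  have total: "z j i = y i + 3 * (\<Sum>l<j. h i (z l))" for i j
    by (induction j) (simp_all add: z algebra_simps)
  show "\<forall>i. 3 * m dvd 3 * h i y"
  proof
    fix i
    have "(\<Sum>l<k. h i (z l)) = 0" using total[of k i] z(3) by simp
    then have "int k * h i y = - (\<Sum>l<k. h i (z l) - h i y)"
      by (simp add: sum_subtractf)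
    moreover have "m dvd (\<Sum>l<k. h i (z l) - h i y)"
      by (intro dvd_sum int_poly_funs_cong[OF h] cong)
    ultimately have A: "m dvd int k * h i y" by simp
    have B: "m dvd 3 * h i y" using m by simp
    have "coprime (3::int) (int k)"
      using prime_imp_coprime[of "3::int" "int k"] k by (simp add: int_dvd_int_iff[of 3, simplified])
    then obtain a b where "a * 3 + b * int k = 1"
      by (metis bezout_int coprime_iff_gcd_eq_1)
    then have "h i y = a * (3 * h i y) + b * (int k * h i y)" 
      by (metis distrib_right mult.assoc mult_1)
    then have "m dvd h i y" using A B by (metis dvd_add dvd_mult)
    then show "3 * m dvd 3 * h i y" by simp
  qed
qed

text \<open>
  The congruence of the values modulo \<open>m\<close> only gives back that \<open>m\<close> divides \<open>3 h(y)\<close>, so one more order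
  is needed. With \<open>d = 3 h(y)\<close>, the cycle is \<open>y\<close>, \<open>y + d\<close> and, modulo \<open>3 m\<close>, \<open>y - d\<close> (as \<open>2 d\<close> and \<open>- d\<close>
  differ by \<open>3 d\<close>). The symmetry about \<open>y\<close> makes the linear terms in \<open>h(y) + h(y + d) + h(y - d)\<close>
  cancel, which leaves \<open>3 h(y)\<close> modulo \<open>3 m\<close>. This is where an odd prime is needed: for \<open>2\<close> the
  map \<open>y \<mapsto> - y\<close> is congruent to the identity and has points of period \<open>2\<close>.
\<close>

lemma perturb_periodic_three:
  assumes h: "\<And>i. h i \<in> int_poly_funs n" and per: "(perturb h ^^ 3) y = y"
  shows "perturb h y = y"
proof (rule perturb_fixed_if_improves)
  fix m :: int assume m: "3 dvd m" "\<forall>i. m dvd 3 * h i y"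
  define d where "d i = 3 * h i y" for i
  define y1 where "y1 = perturb h y"
  define y2 where "y2 = perturb h y1"
  have y1: "y1 = (\<lambda>i. y i + d i)" by (simp add: y1_def perturb_def d_def)
  have y2: "y2 i = y i + d i + 3 * h i y1" for i by (simp add: y2_def perturb_def y1)
  have y3: "y2 i + 3 * h i y2 = y i" for i
    using fun_cong[OF per, of i] by (simp add: y2_def y1_def eval_nat_numeral) (simp add: perturb_def)
  have c1: "m dvd h i y1 - h i y" for i
    using m(2) by (intro int_poly_funs_cong[OF h]) (simp add: y1 d_def)
  show "\<forall>i. 3 * m dvd 3 * h i y"
  proof
    fix i
    have "3 * m dvd m\<^sup>2" using m(1) by (simp add: power2_eq_square)
    then have "3 * m dvd h i y1 + h i (\<lambda>j. y j - d j) - 2 * h i y"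
      using int_poly_funs_second_difference[OF h[of i], of m d y] m(2)
      unfolding y1 d_def by (meson dvd_trans)
    moreover have "3 * m dvd h i y2 - h i (\<lambda>j. y j - d j)"
    proof (intro int_poly_funs_cong[OF h])
      fix j
      have "y2 j - (y j - d j) = 3 * (h j y1 - h j y) + 3 * d j"
        by (simp add: y2 d_def)
      moreover have "3 * m dvd 3 * d j" using m(2) unfolding d_def by (intro mult_dvd_mono) auto
      ultimately show "3 * m dvd y2 j - (y j - d j)"
        using c1[of j] by (metis dvd_add dvd_mult_cancel_left dvd_refl mult_dvd_mono)
    qed
    ultimately have "3 * m dvd (h i y1 + h i (\<lambda>j. y j - d j) - 2 * h i y)
        + (h i y2 - h i (\<lambda>j. y j - d j))"
      by (rule dvd_add)
    moreover have "h i y + h i y1 + h i y2 = 0"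
      using y3[of i] y2[of i] by (simp add: d_def)
    moreover have "(h i y1 + h i (\<lambda>j. y j - d j) - 2 * h i y) + (h i y2 - h i (\<lambda>j. y j - d j))
        = (h i y + h i y1 + h i y2) - 3 * h i y"
      by simp
    ultimately have "3 * m dvd - (3 * h i y)" by simp
    then show "3 * m dvd 3 * h i y" by simp
  qed
qed

lemma perturb_periodic_is_fixed:
  assumes h: "\<And>i. h i \<in> int_poly_funs n" and per: "(perturb h ^^ k) y = y" and "k > 0"
  shows "perturb h y = y"
  using per \<open>k > 0\<close>
proof (induction k rule: less_induct)
  case (less k)
  show ?case
  proof (cases "3 dvd k")
    case False
    then show ?thesis using perturb_periodic_coprime[OF h less.prems(1)] by blast
  next
    case True
    then obtain l where l: "k = l * 3" by (metis dvd_def mult.commute)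
    obtain g where g: "\<And>i. g i \<in> int_poly_funs n" "perturb h ^^ l = perturb g"
      using perturb_funpow[of h n l] h by blast
    have "(perturb g ^^ 3) y = y"
      using less.prems(1) by (simp only: l funpow_mult g(2)[symmetric])
    then have "(perturb h ^^ l) y = y"
      using perturb_periodic_three g by metis
    then show ?thesis using less.IH[of l] less.prems(2) l by simp
  qed
qed


section \<open>Generated monoids and their action on orbits\<close>

text \<open>
  Elements of the monoid generated by polynomial maps are polynomial maps; on a finite orbit that they
  permute, each of them is inverted by one of its powers.
\<close>

definition point_map :: "nat \<Rightarrow> (nat \<Rightarrow> (nat \<Rightarrow> int) \<Rightarrow> int) \<Rightarrow> int list \<Rightarrow> int list" where
  "point_map n q a = map (\<lambda>i. q i ((!) a)) [0..<n]"

lemma pexp_eval_int_poly_funs: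
  "pexp_vars e \<subseteq> {..<n} \<Longrightarrow> \<exists>p \<in> int_poly_funs n. \<forall>a. pexp_eval a e = p ((!) a)"
proof (induction e)
  case (PConst c)
  show ?case by (rule bexI[of _ "\<lambda>_. c"]) (auto intro: int_poly_funs.const)
next
  case (PVar i)
  then show ?case by (intro bexI[of _ "\<lambda>y. y i"]) (auto intro: int_poly_funs.var)
next
  case (PAdd e1 e2)
  then obtain p1 p2 where "p1 \<in> int_poly_funs n" "p2 \<in> int_poly_funs n"
    "\<forall>a. pexp_eval a e1 = p1 ((!) a)" "\<forall>a. pexp_eval a e2 = p2 ((!) a)" by auto
  then show ?case by (intro bexI[of _ "\<lambda>y. p1 y + p2 y"]) (auto intro: int_poly_funs.add)
next
  case (PMul e1 e2)
  then obtain p1 p2 where "p1 \<in> int_poly_funs n" "p2 \<in> int_poly_funs n"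
    "\<forall>a. pexp_eval a e1 = p1 ((!) a)" "\<forall>a. pexp_eval a e2 = p2 ((!) a)" by auto
  then show ?case by (intro bexI[of _ "\<lambda>y. p1 y * p2 y"]) (auto intro: int_poly_funs.mult)
qed

lemma polynomial_map_point_map:
  assumes "polynomial_map n F"
  shows "\<exists>q. (\<forall>i. q i \<in> int_poly_funs n) \<and> (\<forall>a \<in> int_points n. F a = point_map n q a)"
proof -
  obtain es where es: "es \<in> pexp_tuples n" "\<forall>a \<in> int_points n. F a = pexp_map es a"
    using assms polynomial_map_iff_pexp_map by blast
  have "\<exists>p. p \<in> int_poly_funs n \<and> (i < n \<longrightarrow> (\<forall>a. pexp_eval a (es ! i) = p ((!) a)))" for i
  proof (cases "i < n")
    case True
    then have "pexp_vars (es ! i) \<subseteq> {..<n}" using es(1) by (auto simp: pexp_tuples_def)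
    then show ?thesis using pexp_eval_int_poly_funs by blast
  next
    case False
    then show ?thesis using int_poly_funs.const by blast
  qed
  then obtain q where q: "\<And>i. q i \<in> int_poly_funs n"
      "\<And>i a. i < n \<Longrightarrow> pexp_eval a (es ! i) = q i ((!) a)" by metis
  have "pexp_map es a = point_map n q a" for a
    using es(1) by (intro nth_equalityI) (simp_all add: q(2) pexp_map_def point_map_def pexp_tuples_def)
  then have "\<forall>a \<in> int_points n. F a = point_map n q a" using es(2) by simp
  moreover have "\<forall>i. q i \<in> int_poly_funs n" using q(1) by (rule allI)
  ultimately show ?thesis by (intro exI[of _ q] conjI)
qed

lemma generated_monoid_point_map:
  assumes "\<forall>F \<in> S. polynomial_map n F" "f \<in> generated_monoid S"
  shows "\<exists>q. (\<forall>i. q i \<in> int_poly_funs n) \<and> (\<forall>a \<in> int_points n. f a = point_map n q a)"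
  using assms(2)
proof (induction rule: generated_monoid.induct)
  case id
  have "(if i < n then \<lambda>y. y i else (\<lambda>_. 0)) \<in> int_poly_funs n" for i
    by (cases "i < n") (simp_all add: int_poly_funs.var int_poly_funs.const)
  moreover have "id a = point_map n (\<lambda>i. if i < n then \<lambda>y. y i else (\<lambda>_. 0)) a"
    if "a \<in> int_points n" for a
    by (rule nth_equalityI) (use that in \<open>simp_all add: point_map_def int_points_def\<close>)
  ultimately show ?case
    by (intro exI[of _ "\<lambda>i. if i < n then \<lambda>y. y i else (\<lambda>_. 0)"] conjI allI ballI)
next
  case (comp F g)
  obtain q where q: "\<forall>i. q i \<in> int_poly_funs n" "\<forall>a \<in> int_points n. F a = point_map n q a"
    using polynomial_map_point_map comp.hyps(1) assms(1) by blast
  obtain r where r: "\<forall>i. r i \<in> int_poly_funs n" "\<forall>a \<in> int_points n. g a = point_map n r a"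
    using comp.IH by blast
  have "(F \<circ> g) a = point_map n (\<lambda>i y. q i (\<lambda>j. r j y)) a" if "a \<in> int_points n" for a
  proof -
    have "point_map n r a \<in> int_points n" by (simp add: point_map_def int_points_def)
    moreover have "q i ((!) (point_map n r a)) = q i (\<lambda>j. r j ((!) a))" for i
      by (rule int_poly_funs_agree[OF spec[OF q(1), of i]]) (simp add: point_map_def)
    ultimately show ?thesis using bspec[OF q(2)] bspec[OF r(2) that] by (simp add: point_map_def)
  qed
  moreover have "\<forall>i. (\<lambda>y. q i (\<lambda>j. r j y)) \<in> int_poly_funs n"
    by (intro allI int_poly_funs_compose[of "q _" n r n]) (rule spec[OF q(1)], rule spec[OF r(1)])
  ultimately show ?case
    by (intro exI[of _ "\<lambda>i y. q i (\<lambda>j. r j y)"] conjI ballI)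
qed

lemma generated_monoid_compose:
  "f \<in> generated_monoid S \<Longrightarrow> g \<in> generated_monoid S \<Longrightarrow> f \<circ> g \<in> generated_monoid S"
proof (induction rule: generated_monoid.induct)
  case (comp F f)
  then show ?case using generated_monoid.comp[of F S "f \<circ> g"] by (simp only: comp_assoc)
qed simp

lemma generated_monoid_funpow: "f \<in> generated_monoid S \<Longrightarrow> f ^^ k \<in> generated_monoid S"
proof (induction k)
  case 0
  show ?case using generated_monoid.id by (simp add: id_def)
next
  case (Suc k)
  then show ?case using generated_monoid_compose[of f S "f ^^ k"] by (simp add: o_def)
qed

lemma orbit_iff: "y \<in> orbit S x \<longleftrightarrow> (\<exists>f. f \<in> generated_monoid S \<and> y = f x)"
  unfolding orbit_def mem_Collect_eq by (rule ex_cong1) (rule conj_commute)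

lemma self_in_orbit: "x \<in> orbit S x"
proof -
  have "id x \<in> orbit S x" using generated_monoid.id unfolding orbit_def by blast
  then show ?thesis by simp
qed

lemma orbit_closed: "f \<in> generated_monoid S \<Longrightarrow> y \<in> orbit S x \<Longrightarrow> f y \<in> orbit S x"
proof -
  assume f: "f \<in> generated_monoid S" and "y \<in> orbit S x"
  then obtain g where g: "g \<in> generated_monoid S" "y = g x" using orbit_iff[of y S x] by metis
  have "(f \<circ> g) x \<in> orbit S x"
    unfolding orbit_def using generated_monoid_compose[OF f g(1)] by blast
  then show ?thesis using g(2) by simp
qed

lemma bij_betw_funpow_id:
  assumes "finite A" "bij_betw f A A"
  shows "\<exists>k>0. \<forall>y\<in>A. (f ^^ k) y = y"
proof -
  have bij: "bij_betw (f ^^ k) A A" for k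
  proof (induction k)
    case (Suc k)
    then show ?case using bij_betw_trans[OF Suc assms(2)] by (simp add: o_def)
  qed (simp add: bij_betw_def)
  have "range (\<lambda>k. restrict (f ^^ k) A) \<subseteq> (\<Pi>\<^sub>E a\<in>A. A)"
    using bij_betwE[OF bij] by (auto simp: PiE_iff)
  then have "finite (range (\<lambda>k. restrict (f ^^ k) A))"
    using finite_PiE[OF assms(1), of "\<lambda>_. A"] assms(1) finite_subset by blast
  then have "\<not> inj (\<lambda>k. restrict (f ^^ k) A)"
    using finite_imageD by blast
  then obtain i j where ij: "i < j" "restrict (f ^^ i) A = restrict (f ^^ j) A"
    unfolding inj_def by (metis linorder_neqE_nat)
  have "(f ^^ (j - i)) y = y" if "y \<in> A" for y
  proof -
    have "(f ^^ i) ((f ^^ (j - i)) y) = (f ^^ j) y"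
      using ij(1) by (metis comp_apply funpow_add le_add_diff_inverse less_imp_le)
    also have "\<dots> = (f ^^ i) y" using ij(2) that by (metis restrict_apply)
    finally show ?thesis
      using bij[of i] bij[of "j - i"] that by (metis bij_betwE bij_betw_def inj_onD)
  qed
  then show ?thesis using ij(1) by (intro exI[of _ "j - i"]) auto
qed

section \<open>The bound on periodic orbits\<close>

text \<open>
  The hypotheses say that \<open>T\<close> agrees with the identity to first order at \<open>x\<close>: its value modulo \<open>9\<close> and
  its Jacobian modulo \<open>3\<close>, the latter read off from the values at \<open>x + 3 e\<^sub>j\<close>. Rescaling by
  \<open>y \<mapsto> x + 3 y\<close> therefore turns \<open>T\<close> into a map \<open>perturb h\<close> with \<open>h\<close> an integer polynomial map, and \<open>x\<close>
  into the origin. Coordinates from \<open>n\<close> on are kept at their values in \<open>x\<close>.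
\<close>

lemma int_poly_map_periodic_is_fixed:
  fixes T :: "nat \<Rightarrow> (nat \<Rightarrow> int) \<Rightarrow> int"
  assumes T: "\<And>i. i < n \<Longrightarrow> T i \<in> int_poly_funs n"
    and x: "\<And>i. i < n \<Longrightarrow> 9 dvd T i x - x i"
    and dx: "\<And>i j. i < n \<Longrightarrow> j < n \<Longrightarrow>
      9 dvd T i (\<lambda>l. x l + 3 * of_bool (l = j)) - (x i + 3 * of_bool (i = j))"
    and per: "((\<lambda>y i. if i < n then T i y else x i) ^^ k) x = x" and k: "k > 0"
    and i: "i < n"
  shows "T i x = x i"
proof -
  have "\<exists>h \<in> int_poly_funs n. \<forall>y. T i (\<lambda>l. x l + 3 * y l) = x i + 3 * (y i + 3 * h y)"
    if i: "i < n" for i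
  proof -
    obtain c R where R: "R \<in> int_poly_funs n"
      and eq: "\<And>y. T i (\<lambda>l. x l + 3 * y l) = T i x + 3 * (\<Sum>j<n. c j * y j) + 9 * R y"
      using int_poly_funs_taylor[OF T[OF i], of x 3] by auto
    obtain t where t: "T i x = x i + 9 * t"
      using x[OF i] by (metis add.commute diff_add_cancel dvd_def)
    \<comment> \<open>The expansion at \<open>y = e\<^sub>j\<close>, compared with the hypothesis on the value there.\<close>
    have "\<exists>s. c j = of_bool (i = j) + 3 * s" if j: "j < n" for j
    proof -
      have "(\<Sum>l<n. c l * of_bool (l = j)) = c j"
        using j by (subst sum.cong[OF refl, of _ _ "\<lambda>l. if l = j then c j else 0"]) auto
      then have "9 dvd 9 * t + 3 * c j + 9 * R (\<lambda>l. of_bool (l = j)) - 3 * of_bool (i = j)"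
        using dx[OF i j] by (simp only: eq t) (simp only: algebra_simps add_diff_cancel_left)
      then obtain r where "9 * t + 3 * c j + 9 * R (\<lambda>l. of_bool (l = j)) - 3 * of_bool (i = j) = 9 * r"
        by (metis dvd_def)
      then have "c j = of_bool (i = j) + 3 * (r - t - R (\<lambda>l. of_bool (l = j)))" by simp
      then show ?thesis ..
    qed
    then obtain s where s: "\<And>j. j < n \<Longrightarrow> c j = of_bool (i = j) + 3 * s j" by metis
    have "(\<Sum>j<n. c j * y j) = y i + 3 * (\<Sum>j<n. s j * y j)" for y
    proof -
      have "(\<Sum>j<n. c j * y j) = (\<Sum>j<n. (if j = i then y i else 0) + 3 * (s j * y j))"
        by (rule sum.cong) (auto simp: s algebra_simps)
      also have "\<dots> = y i + 3 * (\<Sum>j<n. s j * y j)"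
        using i by (simp add: sum.distrib sum_distrib_left)
      finally show ?thesis .
    qed
    then have "\<forall>y. T i (\<lambda>l. x l + 3 * y l) = x i + 3 * (y i + 3 * (t + (\<Sum>j<n. s j * y j) + R y))"
      by (simp add: eq t)
    moreover have "(\<lambda>y. t + (\<Sum>j<n. s j * y j) + R y) \<in> int_poly_funs n"
      by (intro int_poly_funs.add int_poly_funs.const int_poly_funs_linear R)
    ultimately show ?thesis by (intro bexI[of _ "\<lambda>y. t + (\<Sum>j<n. s j * y j) + R y"])
  qed
  then obtain h' where h': "\<And>i. i < n \<Longrightarrow> h' i \<in> int_poly_funs n"
      "\<And>i y. i < n \<Longrightarrow> T i (\<lambda>l. x l + 3 * y l) = x i + 3 * (y i + 3 * h' i y)"
    by metis
  define h where "h i = (if i < n then h' i else (\<lambda>_. 0))" for i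
  define G where "G = (\<lambda>y i. if i < n then T i y else x i)"
  have h: "h i \<in> int_poly_funs n" for i using h'(1) by (auto simp: h_def int_poly_funs.const)
  \<comment> \<open>In the coordinates \<open>y\<close>, the map \<open>T\<close> acts as \<open>perturb h\<close> and \<open>x\<close> is the origin.\<close>
  have conj: "(G ^^ m) x = (\<lambda>l. x l + 3 * (perturb h ^^ m) (\<lambda>_. 0) l)
      \<and> (\<forall>l\<ge>n. (perturb h ^^ m) (\<lambda>_. 0) l = 0)" for m
  proof (induction m)
    case (Suc m)
    then show ?case by (auto simp: G_def perturb_def h_def h'(2))
  qed simp
  have "(perturb h ^^ k) (\<lambda>_. 0) = (\<lambda>_. 0)"
    using conj[of k] per by (simp add: G_def fun_eq_iff)
  then have "perturb h (\<lambda>_. 0) = (\<lambda>_. 0)"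
    using perturb_periodic_is_fixed[of h n] h k by blast
  then have "h i (\<lambda>_. 0) = 0" by (simp add: perturb_def fun_eq_iff)
  then show ?thesis using h'(2)[OF i, of "\<lambda>_. 0"] i by (simp add: h_def)
qed

text \<open>
  The point \<open>x + 3 e\<^sub>j\<close>; out of range, \<open>j = n\<close>, it is \<open>x\<close> itself, so that one list of \<open>n + 1\<close> indices
  covers all the points at which residues are taken.
\<close>

definition probe :: "int list \<Rightarrow> nat \<Rightarrow> int list" where
  "probe x j = (if j < length x then x[j := x ! j + 3] else x)"

definition jet :: "nat \<Rightarrow> int list \<Rightarrow> (int list \<Rightarrow> int list) \<Rightarrow> int list" where
  "jet n x f = map (\<lambda>(j, i). f (probe x j) ! i mod 9) (List.product [0..<Suc n] [0..<n])"

text \<open>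
  The map \<open>T\<close> below is \<open>id + g' \<circ> f - g' \<circ> g\<close>. Since \<open>g'\<close> is an integer polynomial map, equal residues of
  \<open>f\<close> and \<open>g\<close> at a point give equal residues of \<open>g' \<circ> f\<close> and \<open>g' \<circ> g\<close> there, so \<open>T\<close> agrees with the identity
  to first order at \<open>x\<close>.
\<close>

lemma equal_jets_imp_equal_values:
  assumes S: "\<forall>F \<in> S. polynomial_map n F" and x: "x \<in> int_points n" and per: "periodic_point S x"
    and f: "f \<in> generated_monoid S" and g: "g \<in> generated_monoid S"
    and jets: "jet n x f = jet n x g"
  shows "f x = g x"
proof -
  let ?O = "orbit S x"
  note pm = generated_monoid_point_map[OF S]
  have fin: "finite ?O" and bij: "\<And>f. f \<in> generated_monoid S \<Longrightarrow> bij_betw f ?O ?O"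
    using per by (auto simp: periodic_point_def)
  have len: "length (f a) = n" if "f \<in> generated_monoid S" "length a = n" for f a
    using pm[OF that(1)] that(2) by (auto simp: int_points_def point_map_def)
  have lenO: "length y = n" if y: "y \<in> ?O" for y
  proof -
    obtain f where "f \<in> generated_monoid S" "y = f x" using y orbit_iff[of y S x] by metis
    then show ?thesis using len x by (simp add: int_points_def)
  qed
  obtain k where k: "k > 0" "\<forall>y\<in>?O. (g ^^ k) y = y"
    using bij_betw_funpow_id[OF fin bij[OF g]] by blast
  define g' where "g' = g ^^ (k - 1)"
  have g': "g' \<in> generated_monoid S" by (simp add: g'_def g generated_monoid_funpow)
  have inv: "g' (g y) = y" if "y \<in> ?O" for y
    using k that by (cases k) (auto simp: g'_def funpow_swap1)
  obtain u where u: "\<And>i. u i \<in> int_poly_funs n" "\<And>a. a \<in> int_points n \<Longrightarrow> (g' \<circ> f) a = point_map n u a"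
    using pm[OF generated_monoid_compose[OF g' f]] by blast
  obtain v where v: "\<And>i. v i \<in> int_poly_funs n" "\<And>a. a \<in> int_points n \<Longrightarrow> (g' \<circ> g) a = point_map n v a"
    using pm[OF generated_monoid_compose[OF g' g]] by blast
  obtain w where w: "\<And>i. w i \<in> int_poly_funs n" "\<And>a. a \<in> int_points n \<Longrightarrow> g' a = point_map n w a"
    using pm[OF g'] by blast
  define T where "T i = (\<lambda>y. y i + (u i y - v i y))" for i
  have T: "T i \<in> int_poly_funs n" if "i < n" for i
    unfolding T_def using that u v by (intro int_poly_funs.add int_poly_funs_diff int_poly_funs.var)
  have uv: "9 dvd u i ((!) (probe x j)) - v i ((!) (probe x j))" if "i < n" "j \<le> n" for i j
  proof -
    let ?p = "probe x j"
    have p: "?p \<in> int_points n" using x by (simp add: probe_def int_points_def)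
    have "f ?p ! l mod 9 = g ?p ! l mod 9" if "l < n" for l
    proof -
      have "(j, l) \<in> set (List.product [0..<Suc n] [0..<n])"
        using \<open>j \<le> n\<close> that by (simp only: set_product set_upt) auto
      then show ?thesis using jets unfolding jet_def map_eq_conv by (metis (no_types, lifting) case_prod_conv)
    qed
    then have "9 dvd w i ((!) (f ?p)) - w i ((!) (g ?p))"
      by (intro int_poly_funs_cong[OF w(1)]) (simp add: mod_eq_dvd_iff)
    moreover have "w i ((!) (f' ?p)) = (g' \<circ> f') ?p ! i" if "f' \<in> generated_monoid S" for f'
      using w(2)[of "f' ?p"] len[OF that, of ?p] p \<open>i < n\<close>
      by (simp add: int_points_def point_map_def)
    ultimately show ?thesis
      using u(2)[OF p] v(2)[OF p] f g \<open>i < n\<close> by (simp add: point_map_def)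
  qed
  define G where "G = (\<lambda>y i. if i < n then T i y else x ! i)"
  have emb: "u i ((!) a) = (g' \<circ> f) a ! i" "v i ((!) a) = (g' \<circ> g) a ! i" if "i < n" "length a = n" for a i
    using u(2)[of a] v(2)[of a] that by (auto simp: int_points_def point_map_def)
  define tail where "tail a = (\<lambda>i. if i < n then a ! i else x ! i)" for a
  \<comment> \<open>On the orbit \<open>g' \<circ> g\<close> is the identity, so there \<open>T\<close> acts as \<open>g' \<circ> f\<close>.\<close>
  have step: "G (tail y) = tail ((g' \<circ> f) y)" if "y \<in> ?O" for y
  proof (intro ext)
    fix i
    have "T i (tail y) = T i ((!) y)" if "i < n"
      by (rule int_poly_funs_agree[OF T[OF that]]) (simp add: tail_def)
    then show "G (tail y) i = tail ((g' \<circ> f) y) i"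
      using emb[of i y] lenO[OF that] inv[OF that] by (auto simp: G_def tail_def T_def)
  qed
  have iter: "(G ^^ m) (tail x) = tail (((g' \<circ> f) ^^ m) x)" for m
  proof (induction m)
    case (Suc m)
    have "((g' \<circ> f) ^^ m) x \<in> ?O"
      by (rule orbit_closed[OF generated_monoid_funpow[OF generated_monoid_compose[OF g' f]] self_in_orbit])
    then show ?case using Suc step by (simp add: o_def)
  qed simp
  have tx: "tail x = (!) x" by (auto simp: tail_def)
  obtain m where m0: "m > 0" and all: "\<forall>y\<in>?O. ((g' \<circ> f) ^^ m) y = y"
    using bij_betw_funpow_id[OF fin bij[OF generated_monoid_compose[OF g' f]]] by (elim exE conjE)
  have mx: "((g' \<circ> f) ^^ m) x = x" by (rule bspec[OF all self_in_orbit])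
  have fixed: "T i ((!) x) = x ! i" if "i < n" for i
  proof (rule int_poly_map_periodic_is_fixed[of n T "(!) x" m i])
    show "9 dvd T i ((!) x) - x ! i" if "i < n" for i
      using uv[OF that, of n] x by (simp add: T_def probe_def int_points_def)
    show "9 dvd T i (\<lambda>l. x ! l + 3 * of_bool (l = j)) - (x ! i + 3 * of_bool (i = j))"
      if "i < n" "j < n" for i j
    proof -
      have "T i (\<lambda>l. x ! l + 3 * of_bool (l = j)) = T i ((!) (probe x j))"
        using that x by (intro int_poly_funs_agree[OF T]) (auto simp: probe_def int_points_def nth_list_update)
      moreover have "probe x j ! i = x ! i + 3 * of_bool (i = j)"
        using that x by (auto simp: probe_def int_points_def nth_list_update)
      ultimately show ?thesis using uv[of i j] that by (simp add: T_def)
    qed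
    show "((\<lambda>y i. if i < n then T i y else x ! i) ^^ m) ((!) x) = (!) x"
      using iter[of m] mx by (simp add: tx G_def)
    show "T i \<in> int_poly_funs n" if "i < n" for i by (rule T[OF that])
  qed (rule m0, rule that)
  have "(g' \<circ> f) x = x"
  proof (rule nth_equalityI)
    have lx: "length x = n" using x by (simp add: int_points_def)
    show "length ((g' \<circ> f) x) = length x"
      using len[OF generated_monoid_compose[OF g' f] lx] lx by simp
    show "(g' \<circ> f) x ! i = x ! i" if "i < length ((g' \<circ> f) x)" for i
      using that fixed[of i] emb[of i x] len[OF generated_monoid_compose[OF g' f] lx] lx inv[OF self_in_orbit]
      by (simp add: T_def)
  qed
  then have "g' (f x) = g' (g x)" using inv[OF self_in_orbit] by simp
  then show ?thesis
    by (rule inj_onD[OF bij_betw_imp_inj_on[OF bij[OF g']]])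
       (rule orbit_closed[OF f self_in_orbit] orbit_closed[OF g self_in_orbit])+
qed

text \<open>
  Choosing for each point \<open>y\<close> of the orbit some \<open>f\<close> in the monoid with \<open>f x = y\<close> gives an injection of the
  orbit into the lists of \<open>n (n + 1)\<close> residues modulo \<open>9\<close>.
\<close>

lemma card_orbit_le:
  assumes "\<forall>F \<in> S. polynomial_map n F" "x \<in> int_points n" "periodic_point S x"
  shows "card (orbit S x) \<le> 9 ^ (Suc n * n)"
proof -
  let ?L = "{l. set l \<subseteq> {0..<9::int} \<and> length l = Suc n * n}"
  define F where "F y = (SOME f. f \<in> generated_monoid S \<and> y = f x)" for y
  have F: "F y \<in> generated_monoid S \<and> y = F y x" if "y \<in> orbit S x" for y
    unfolding F_def using that unfolding orbit_iff by (rule someI_ex)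
  have "inj_on (\<lambda>y. jet n x (F y)) (orbit S x)"
  proof (rule inj_onI)
    fix y z assume yz: "y \<in> orbit S x" "z \<in> orbit S x" "jet n x (F y) = jet n x (F z)"
    have "F y x = F z x"
      using equal_jets_imp_equal_values[OF assms _ _ yz(3)] F[OF yz(1)] F[OF yz(2)] by blast
    then show "y = z" using F[OF yz(1)] F[OF yz(2)] by simp
  qed
  moreover have "(\<lambda>y. jet n x (F y)) ` orbit S x \<subseteq> ?L"
  proof clarify
    fix y
    show "set (jet n x (F y)) \<subseteq> {0..<9} \<and> length (jet n x (F y)) = Suc n * n"
      unfolding jet_def by (simp add: case_prod_beta image_subset_iff del: upt_Suc mult_Suc)
  qed
  moreover have "finite ?L" by (rule finite_lists_length_eq) simp
  ultimately have "card (orbit S x) \<le> card ?L" by (rule card_inj_on_le)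
  also have "\<dots> = 9 ^ (Suc n * n)" by (subst card_lists_length_eq) auto
  finally show ?thesis .
qed


section \<open>Programs as transformations of encoded values\<close>

fun assigned :: "prog \<Rightarrow> nat set" where
  "assigned Skip = {}"
| "assigned (Assign v e) = {v}"
| "assigned (Seq c c') = assigned c \<union> assigned c'"
| "assigned (If b c c') = assigned c \<union> assigned c'"
| "assigned (While b c) = assigned c"

lemma finite_assigned: "finite (assigned c)"
  by (induction c) auto

lemma runs_unassigned: "runs c s k t \<Longrightarrow> v \<notin> assigned c \<Longrightarrow> t v = s v"
  by (induction rule: runs.induct) auto

text \<open>
  One program must serve all \<open>x \<in> A\<close>, with input \<open>u x\<close>, output \<open>v x\<close> and at most \<open>\<kappa> x\<close> arithmetic operations.
  Input and output are both families over the same index \<open>x\<close>, so that they can be arbitrary encodings of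
  typed data. The other variables hold arbitrary values at the start: programs can then be composed
  without regard to what earlier ones left behind.
\<close>

definition transforms :: "'a set \<Rightarrow> ('a \<Rightarrow> val) \<Rightarrow> ('a \<Rightarrow> val) \<Rightarrow> ('a \<Rightarrow> nat) \<Rightarrow> bool" where
  "transforms A u v \<kappa> \<longleftrightarrow>
     (\<exists>c. \<forall>x\<in>A. \<forall>s. s 0 = u x \<longrightarrow> (\<exists>k\<le>\<kappa> x. \<exists>t. runs c s k t \<and> t 0 = v x))"

lemma transformsI:
  assumes "\<And>x s. x \<in> A \<Longrightarrow> s 0 = u x \<Longrightarrow> \<exists>k\<le>\<kappa> x. \<exists>t. runs c s k t \<and> t 0 = v x"
  shows "transforms A u v \<kappa>"
  using assms unfolding transforms_def by blast

lemma transformsE: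
  assumes "transforms A u v \<kappa>"
  obtains c where "\<And>x s. x \<in> A \<Longrightarrow> s 0 = u x \<Longrightarrow> \<exists>k\<le>\<kappa> x. \<exists>t. runs c s k t \<and> t 0 = v x"
  using assms unfolding transforms_def by blast

lemma transforms_computes:
  assumes "transforms A u v \<kappa>"
  shows "\<exists>c. \<forall>x\<in>A. \<exists>k\<le>\<kappa> x. computes c (u x) k (v x)"
proof -
  obtain c where c: "\<And>x s. x \<in> A \<Longrightarrow> s 0 = u x \<Longrightarrow> \<exists>k\<le>\<kappa> x. \<exists>t. runs c s k t \<and> t 0 = v x"
    using assms by (rule transformsE[OF _ that])
  have "\<exists>k\<le>\<kappa> x. computes c (u x) k (v x)" if "x \<in> A" for x
    unfolding computes_def by (rule c[OF that]) simp
  then show ?thesis by blast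
qed

lemma transforms_reindex:
  assumes "transforms B u v \<kappa>"
    and "\<And>x. x \<in> A \<Longrightarrow> h x \<in> B \<and> u' x = u (h x) \<and> v' x = v (h x) \<and> \<kappa> (h x) \<le> \<kappa>' x"
  shows "transforms A u' v' \<kappa>'"
proof -
  obtain c where c: "\<And>x s. x \<in> B \<Longrightarrow> s 0 = u x \<Longrightarrow> \<exists>k\<le>\<kappa> x. \<exists>t. runs c s k t \<and> t 0 = v x"
    using assms(1) by (rule transformsE[OF _ that])
  show ?thesis
  proof (rule transformsI)
    fix x and s :: store assume "x \<in> A" "s 0 = u' x"
    then show "\<exists>k\<le>\<kappa>' x. \<exists>t. runs c s k t \<and> t 0 = v' x"
      using c[of "h x" s] assms(2)[of x] by (metis order_trans)
  qed
qed

lemma transforms_weaken: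
  assumes "transforms B u v \<kappa>" "A \<subseteq> B" "\<And>x. x \<in> A \<Longrightarrow> v' x = v x" "\<And>x. x \<in> A \<Longrightarrow> \<kappa> x \<le> \<kappa>' x"
  shows "transforms A u v' \<kappa>'"
  by (rule transforms_reindex[OF assms(1), where h = "\<lambda>x. x"]) (use assms(2-) in auto)

lemma transforms_expr:
  assumes "\<And>x (s :: store). x \<in> A \<Longrightarrow> s 0 = u x \<Longrightarrow> expr_val e s = v x" "\<And>x. x \<in> A \<Longrightarrow> expr_cost e \<le> \<kappa> x"
  shows "transforms A u v \<kappa>"
proof (rule transformsI)
  fix x and s :: store assume "x \<in> A" "s 0 = u x"
  then show "\<exists>k\<le>\<kappa> x. \<exists>t. runs (Assign 0 e) s k t \<and> t 0 = v x"
    using assms runs.Assign[of 0 e s] by fastforce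
qed

lemma transforms_seq:
  assumes "transforms A u v \<kappa>" "transforms A v w \<kappa>'"
  shows "transforms A u w (\<lambda>x. \<kappa> x + \<kappa>' x)"
proof -
  obtain c where c: "\<And>x s. x \<in> A \<Longrightarrow> s 0 = u x \<Longrightarrow> \<exists>k\<le>\<kappa> x. \<exists>t. runs c s k t \<and> t 0 = v x"
    using assms(1) by (rule transformsE[OF _ that])
  obtain c' where c': "\<And>x s. x \<in> A \<Longrightarrow> s 0 = v x \<Longrightarrow> \<exists>k\<le>\<kappa>' x. \<exists>t. runs c' s k t \<and> t 0 = w x"
    using assms(2) by (rule transformsE[OF _ that])
  show ?thesis
  proof (rule transformsI)
    fix x and s :: store assume x: "x \<in> A" "s 0 = u x"
    obtain k t where 1: "k \<le> \<kappa> x" "runs c s k t" "t 0 = v x" using c[of x s, OF x] by blast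
    obtain k' t' where 2: "k' \<le> \<kappa>' x" "runs c' t k' t'" "t' 0 = w x" using c'[of x t, OF x(1) 1(3)] by blast
    show "\<exists>k\<le>\<kappa> x + \<kappa>' x. \<exists>t. runs (Seq c c') s k t \<and> t 0 = w x"
      using runs.Seq[OF 1(2) 2(2)] 1(1) 2(1,3) add_mono by blast
  qed
qed

text \<open>
  The rule for using a program as a subroutine: an expression without arithmetic arranges its argument
  \<open>w (h x)\<close>.
\<close>

lemma transforms_call:
  assumes "transforms B w v \<kappa>"
    and "\<And>x s. x \<in> A \<Longrightarrow> s 0 = u x \<Longrightarrow> expr_val e s = w (h x)" "expr_cost e = 0"
    and "\<And>x. x \<in> A \<Longrightarrow> h x \<in> B" "\<And>x. x \<in> A \<Longrightarrow> v (h x) = v' x" "\<And>x. x \<in> A \<Longrightarrow> \<kappa> (h x) \<le> \<kappa>' x"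
  shows "transforms A u v' \<kappa>'"
proof -
  have "transforms A u (\<lambda>x. w (h x)) (\<lambda>_. 0)"
    by (rule transforms_expr[where e = e]) (use assms(2,3) in auto)
  moreover have "transforms A (\<lambda>x. w (h x)) v' \<kappa>'"
    by (rule transforms_reindex[OF assms(1), where h = h]) (use assms(4-) in auto)
  ultimately show ?thesis using transforms_seq by fastforce
qed

text \<open>
  Both programs overwrite variable \<open>0\<close>, so the input and the first result are kept in variables \<open>i\<close> and
  \<open>j\<close> that neither program assigns.
\<close>

lemma transforms_pair:
  assumes "transforms A u v \<kappa>" "transforms A u w \<kappa>'"
  shows "transforms A u (\<lambda>x. Pair (v x) (w x)) (\<lambda>x. \<kappa> x + \<kappa>' x)"
proof -
  obtain c where c: "\<And>x s. x \<in> A \<Longrightarrow> s 0 = u x \<Longrightarrow> \<exists>k\<le>\<kappa> x. \<exists>t. runs c s k t \<and> t 0 = v x"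
    using assms(1) by (rule transformsE[OF _ that])
  obtain c' where c': "\<And>x s. x \<in> A \<Longrightarrow> s 0 = u x \<Longrightarrow> \<exists>k\<le>\<kappa>' x. \<exists>t. runs c' s k t \<and> t 0 = w x"
    using assms(2) by (rule transformsE[OF _ that])
  obtain i where i: "i \<notin> assigned c \<union> assigned c' \<union> {0}"
    using ex_new_if_finite[of "assigned c \<union> assigned c' \<union> {0}"] finite_assigned by auto
  obtain j where j: "j \<notin> assigned c \<union> assigned c' \<union> {0, i}"
    using ex_new_if_finite[of "assigned c \<union> assigned c' \<union> {0, i}"] finite_assigned by auto
  let ?p = "Seq (Assign i (Var 0)) (Seq c (Seq (Assign j (Var 0)) (Seq (Assign 0 (Var i))
    (Seq c' (Assign 0 (PairE (Var j) (Var 0)))))))"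
  show ?thesis
  proof (rule transformsI)
    fix x and s :: store assume x: "x \<in> A" "s 0 = u x"
    let ?s1 = "s(i := s 0)"
    have "?s1 0 = u x" using x i by simp
    then obtain k t where 1: "k \<le> \<kappa> x" "runs c ?s1 k t" "t 0 = v x" using c[OF x(1)] by blast
    have ti: "t i = u x" using runs_unassigned[OF 1(2), of i] i x by simp
    let ?s2 = "t(j := t 0, 0 := t i)"
    have "?s2 0 = u x" using ti by simp
    then obtain k' t' where 2: "k' \<le> \<kappa>' x" "runs c' ?s2 k' t'" "t' 0 = w x" using c'[OF x(1)] by blast
    have tj: "t' j = v x" using runs_unassigned[OF 2(2), of j] j 1(3) by simp
    have "runs (Assign i (Var 0)) s 0 ?s1" using runs.Assign[of i "Var 0" s] by simp
    moreover have "runs (Assign j (Var 0)) t 0 (t(j := t 0))" using runs.Assign[of j "Var 0" t] by simp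
    moreover have "runs (Assign 0 (Var i)) (t(j := t 0)) 0 ?s2"
      using runs.Assign[of 0 "Var i" "t(j := t 0)"] j by simp
    moreover have "runs (Assign 0 (PairE (Var j) (Var 0))) t' 0 (t'(0 := Pair (v x) (w x)))"
      using runs.Assign[of 0 "PairE (Var j) (Var 0)" t'] tj 2(3) by simp
    ultimately have "runs ?p s (0 + (k + (0 + (0 + (k' + 0))))) (t'(0 := Pair (v x) (w x)))"
      using 1(2) 2(2) by (intro runs.Seq)
    then show "\<exists>k\<le>\<kappa> x + \<kappa>' x. \<exists>t. runs ?p s k t \<and> t 0 = Pair (v x) (w x)"
      using 1(1) 2(1) by (intro exI[of _ "k + k'"] conjI exI[of _ "t'(0 := Pair (v x) (w x))"]) auto
  qed
qed

lemma transforms_if_test: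
  assumes "\<And>x s. x \<in> A \<Longrightarrow> s 0 = u x \<Longrightarrow> test_val b s = P x" "test_cost b = 0"
    and "transforms {x \<in> A. P x} u v \<kappa>" "transforms {x \<in> A. \<not> P x} u v \<kappa>"
  shows "transforms A u v \<kappa>"
proof -
  obtain c where c: "\<And>x s. x \<in> {x \<in> A. P x} \<Longrightarrow> s 0 = u x \<Longrightarrow> \<exists>k\<le>\<kappa> x. \<exists>t. runs c s k t \<and> t 0 = v x"
    using assms(3) by (rule transformsE[OF _ that])
  obtain c' where c': "\<And>x s. x \<in> {x \<in> A. \<not> P x} \<Longrightarrow> s 0 = u x \<Longrightarrow> \<exists>k\<le>\<kappa> x. \<exists>t. runs c' s k t \<and> t 0 = v x"
    using assms(4) by (rule transformsE[OF _ that])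
  show ?thesis
  proof (rule transformsI)
    fix x and s :: store assume x: "x \<in> A" "s 0 = u x"
    show "\<exists>k\<le>\<kappa> x. \<exists>t. runs (If b c c') s k t \<and> t 0 = v x"
    proof (cases "P x")
      case True
      then obtain k t where 1: "k \<le> \<kappa> x" "runs c s k t" "t 0 = v x" using c[of x s] x by blast
      then have "runs (If b c c') s (test_cost b + k) t"
        using True assms(1)[of x s, OF x] by (intro runs.IfTrue) auto
      then show ?thesis using 1 assms(2) by auto
    next
      case False
      then obtain k t where 1: "k \<le> \<kappa> x" "runs c' s k t" "t 0 = v x" using c'[of x s] x by blast
      then have "runs (If b c c') s (test_cost b + k) t"
        using False assms(1)[of x s, OF x] by (intro runs.IfFalse) auto
      then show ?thesis using 1 assms(2) by auto
    qed
  qed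
qed

text \<open>
  The output \<open>v\<close> is constant along the iteration of \<open>f\<close> and is read off when the test fails; \<open>m\<close> decreases,
  and \<open>K\<close> bounds the cost that remains.
\<close>

lemma transforms_while:
  fixes m :: "'a \<Rightarrow> nat"
  assumes test: "\<And>x s. x \<in> A \<Longrightarrow> s 0 = u x \<Longrightarrow> test_val b s = P x" "test_cost b = 0"
    and body: "transforms {x \<in> A. P x} u (\<lambda>x. u (f x)) \<kappa>"
    and closed: "\<And>x. x \<in> A \<Longrightarrow> P x \<Longrightarrow> f x \<in> A" and dec: "\<And>x. x \<in> A \<Longrightarrow> P x \<Longrightarrow> m (f x) < m x"
    and stop: "\<And>x. x \<in> A \<Longrightarrow> \<not> P x \<Longrightarrow> v x = u x" and go: "\<And>x. x \<in> A \<Longrightarrow> P x \<Longrightarrow> v (f x) = v x"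
    and cost: "\<And>x. x \<in> A \<Longrightarrow> P x \<Longrightarrow> \<kappa> x + K (f x) \<le> K x"
  shows "transforms A u v K"
proof -
  obtain c where c: "\<And>x s. x \<in> {x \<in> A. P x} \<Longrightarrow> s 0 = u x \<Longrightarrow> \<exists>k\<le>\<kappa> x. \<exists>t. runs c s k t \<and> t 0 = u (f x)"
    using body by (rule transformsE[OF _ that])
  have "\<exists>k\<le>K x. \<exists>t. runs (While b c) s k t \<and> t 0 = v x" if "x \<in> A" "s 0 = u x" for x and s :: store
    using that
  proof (induction "m x" arbitrary: x s rule: less_induct)
    case less
    note x = less.prems
    show ?case
    proof (cases "P x")
      case False
      then have "runs (While b c) s 0 s"
        using runs.WhileFalse[of b s c] test(1)[of x s, OF x] test(2) by simp
      then show ?thesis using x False stop by fastforce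
    next
      case True
      then obtain k t where 1: "k \<le> \<kappa> x" "runs c s k t" "t 0 = u (f x)" using c[of x s] x by blast
      obtain k' t' where 2: "k' \<le> K (f x)" "runs (While b c) t k' t'" "t' 0 = v (f x)"
        using less.hyps[of "f x" t, OF dec closed 1(3)] x(1) True by blast
      have "runs (While b c) s (test_cost b + k + k') t'"
        using True test(1)[of x s, OF x] 1(2) 2(2) by (intro runs.WhileTrue) auto
      moreover have "test_cost b + k + k' \<le> K x" using 1(1) 2(1) cost[OF x(1) True] test(2) by simp
      ultimately show ?thesis using 2(3) go[OF x(1) True] by auto
    qed
  qed
  then show ?thesis by (rule transformsI)
qed

definition bool_val :: "bool \<Rightarrow> val" where
  "bool_val b = IntV (if b then 1 else 0)"

lemma transforms_if:
  assumes "transforms A u (\<lambda>x. bool_val (P x)) \<kappa>"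
    and "transforms {x \<in> A. P x} u v \<kappa>'" "transforms {x \<in> A. \<not> P x} u v \<kappa>'"
  shows "transforms A u v (\<lambda>x. \<kappa> x + \<kappa>' x)"
proof -
  let ?w = "\<lambda>x. Pair (bool_val (P x)) (u x)"
  have "transforms A u u (\<lambda>_. 0)" by (rule transforms_expr[where e = "Var 0"]) auto
  then have "transforms A u ?w \<kappa>" using transforms_pair[OF assms(1)] by fastforce
  moreover have "transforms A ?w v \<kappa>'"
  proof (rule transforms_if_test[where b = "EqInt (Fst (Var 0)) (Lit 1)" and P = P])
    show "transforms {x \<in> A. P x} ?w v \<kappa>'"
      by (rule transforms_call[OF assms(2), where e = "Snd (Var 0)" and h = "\<lambda>x. x"]) auto
    show "transforms {x \<in> A. \<not> P x} ?w v \<kappa>'"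
      by (rule transforms_call[OF assms(3), where e = "Snd (Var 0)" and h = "\<lambda>x. x"]) auto
  qed (auto simp: bool_val_def)
  ultimately show ?thesis by (rule transforms_seq)
qed

lemma transforms_test:
  assumes "\<And>x s. x \<in> A \<Longrightarrow> s 0 = u x \<Longrightarrow> test_val b s = P x" "test_cost b = 0"
  shows "transforms A u (\<lambda>x. bool_val (P x)) (\<lambda>_. 0)"
  using assms
proof (rule transforms_if_test)
  show "transforms {x \<in> A. P x} u (\<lambda>x. bool_val (P x)) (\<lambda>_. 0)"
    by (rule transforms_expr[where e = "Lit 1"]) (auto simp: bool_val_def)
  show "transforms {x \<in> A. \<not> P x} u (\<lambda>x. bool_val (P x)) (\<lambda>_. 0)"
    by (rule transforms_expr[where e = "Lit 0"]) (auto simp: bool_val_def)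
qed

lemma transforms_conj:
  assumes "transforms A u (\<lambda>x. bool_val (P x)) \<kappa>" "transforms A u (\<lambda>x. bool_val (Q x)) \<kappa>'"
  shows "transforms A u (\<lambda>x. bool_val (P x \<and> Q x)) (\<lambda>x. \<kappa> x + \<kappa>' x)"
  using assms(1)
proof (rule transforms_if)
  show "transforms {x \<in> A. P x} u (\<lambda>x. bool_val (P x \<and> Q x)) \<kappa>'"
    by (rule transforms_weaken[OF assms(2)]) auto
  show "transforms {x \<in> A. \<not> P x} u (\<lambda>x. bool_val (P x \<and> Q x)) \<kappa>'"
    by (rule transforms_expr[where e = "Lit 0"]) (auto simp: bool_val_def)
qed

lemma transforms_not:
  assumes "transforms A u (\<lambda>x. bool_val (P x)) \<kappa>"
  shows "transforms A u (\<lambda>x. bool_val (\<not> P x)) \<kappa>"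
proof -
  have "transforms A (\<lambda>x. bool_val (P x)) (\<lambda>x. bool_val (\<not> P x)) (\<lambda>_. 0)"
    by (rule transforms_test[where b = "EqInt (Var 0) (Lit 0)"]) (auto simp: bool_val_def)
  from transforms_seq[OF assms this] show ?thesis by simp
qed

section \<open>Loops over lists\<close>

text \<open>
  The step sees the whole input \<open>u x\<close> besides the accumulator and the current element, so nested loops
  need no separate treatment of their environment. As the cost of a step may depend on the
  accumulator, which grows in the search below, the total cost is an arbitrary \<open>K\<close> that satisfies the
  recursive estimate.
\<close>

lemma transforms_foldl:
  assumes init: "transforms A u (\<lambda>x. eb (b0 x)) (\<lambda>_. 0)"
    and list: "transforms A u (\<lambda>x. encode_list (map ey (ys x))) (\<lambda>_. 0)"
    and step: "transforms {(x, b, y). x \<in> A \<and> b \<in> I x \<and> y \<in> set (ys x)}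
      (\<lambda>(x, b, y). Pair (u x) (Pair (eb b) (ey y))) (\<lambda>(x, b, y). eb (f x b y)) (\<lambda>(x, b, y). \<kappa> x b y)"
    and inv: "\<And>x. x \<in> A \<Longrightarrow> b0 x \<in> I x"
      "\<And>x b y. x \<in> A \<Longrightarrow> b \<in> I x \<Longrightarrow> y \<in> set (ys x) \<Longrightarrow> f x b y \<in> I x"
    and cost: "\<And>x b y zs. x \<in> A \<Longrightarrow> b \<in> I x \<Longrightarrow> y \<in> set (ys x) \<Longrightarrow>
      \<kappa> x b y + K x (f x b y) zs \<le> K x b (y # zs)"
  shows "transforms A u (\<lambda>x. eb (foldl (f x) (b0 x) (ys x))) (\<lambda>x. K x (b0 x) (ys x))"
proof -
  let ?S = "{(x, b, zs). x \<in> A \<and> b \<in> I x \<and> set zs \<subseteq> set (ys x)}"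
  let ?P = "\<lambda>(x, b, zs). zs \<noteq> []"
  let ?w = "\<lambda>(x, b, zs). Pair (u x) (Pair (eb b) (encode_list (map ey zs)))"
  let ?g = "\<lambda>(x, b, zs). (x, f x b (hd zs), tl zs)"
  let ?h = "\<lambda>(x, b, zs). (x, b, hd zs)"
  have "transforms A u u (\<lambda>_. 0)" by (rule transforms_expr[where e = "Var 0"]) auto
  from transforms_pair[OF this transforms_pair[OF init list]]
  have start: "transforms A u (\<lambda>x. ?w (x, b0 x, ys x)) (\<lambda>_. 0)" by simp
  have env: "transforms {x \<in> ?S. ?P x} ?w (\<lambda>(x, b, zs). u x) (\<lambda>_. 0)"
    by (rule transforms_expr[where e = "Fst (Var 0)"]) auto
  have rest: "transforms {x \<in> ?S. ?P x} ?w (\<lambda>(x, b, zs). encode_list (map ey (tl zs))) (\<lambda>_. 0)"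
    by (rule transforms_expr[where e = "Snd (Snd (Snd (Var 0)))"]) (auto simp: neq_Nil_conv)
  have acc: "transforms {x \<in> ?S. ?P x} ?w (\<lambda>(x, b, zs). eb (f x b (hd zs)))
      (\<lambda>(x, b, zs). \<kappa> x b (hd zs))"
    by (rule transforms_call[OF step, where h = ?h and e = "PairE (Fst (Var 0))
          (PairE (Fst (Snd (Var 0))) (Fst (Snd (Snd (Var 0)))))"])
       (auto simp: neq_Nil_conv)
  have loop: "transforms ?S ?w (\<lambda>(x, b, zs). ?w (x, foldl (f x) b zs, [])) (\<lambda>(x, b, zs). K x b zs)"
  proof (rule transforms_while[where b = "IsPair (Snd (Snd (Var 0)))" and P = ?P and f = ?g
        and m = "\<lambda>(x, b, zs). length zs" and \<kappa> = "\<lambda>(x, b, zs). \<kappa> x b (hd zs)"])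
    show "transforms {x \<in> ?S. ?P x} ?w (\<lambda>x. ?w (?g x)) (\<lambda>(x, b, zs). \<kappa> x b (hd zs))"
      by (rule transforms_weaken[OF transforms_pair[OF env transforms_pair[OF acc rest]]]) auto
    show "test_val (IsPair (Snd (Snd (Var 0)))) s = ?P q" if "q \<in> ?S" "s 0 = ?w q" for q s
      using that by (auto simp: neq_Nil_conv) (metis encode_list.elims list.discI map_is_Nil_conv neq_Nil_conv val.distinct(3))
    show "?g q \<in> ?S" if "q \<in> ?S" "?P q" for q
      using that inv(2) by (auto simp: neq_Nil_conv)
    show "(\<lambda>(x, b, zs). ?w (x, foldl (f x) b zs, [])) (?g q) = (\<lambda>(x, b, zs). ?w (x, foldl (f x) b zs, [])) q"
      if "q \<in> ?S" "?P q" for q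
      using that by (auto simp: neq_Nil_conv)
    show "(\<lambda>(x, b, zs). \<kappa> x b (hd zs)) q + (\<lambda>(x, b, zs). K x b zs) (?g q) \<le> (\<lambda>(x, b, zs). K x b zs) q"
      if "q \<in> ?S" "?P q" for q
      using that cost by (auto simp: neq_Nil_conv)
  qed auto
  have "transforms A (\<lambda>x. ?w (x, b0 x, ys x)) (\<lambda>x. ?w (x, foldl (f x) (b0 x) (ys x), []))
      (\<lambda>x. K x (b0 x) (ys x))"
    by (rule transforms_reindex[OF loop, where h = "\<lambda>x. (x, b0 x, ys x)"]) (auto simp: inv(1))
  moreover have "transforms A (\<lambda>x. ?w (x, foldl (f x) (b0 x) (ys x), []))
      (\<lambda>x. eb (foldl (f x) (b0 x) (ys x))) (\<lambda>_. 0)"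
    by (rule transforms_expr[where e = "Fst (Snd (Var 0))"]) auto
  ultimately have "transforms A (\<lambda>x. ?w (x, b0 x, ys x)) (\<lambda>x. eb (foldl (f x) (b0 x) (ys x)))
      (\<lambda>x. K x (b0 x) (ys x))"
    using transforms_seq by fastforce
  from transforms_seq[OF start this] show ?thesis by simp
qed

lemma transforms_rev: "transforms UNIV encode_list (\<lambda>zs. encode_list (rev zs)) (\<lambda>_. 0)"
proof -
  have "transforms UNIV encode_list (\<lambda>zs. encode_list (foldl (\<lambda>b y. y # b) [] zs)) (\<lambda>x. 0)"
  proof (rule transforms_foldl[where ey = "\<lambda>y. y" and I = "\<lambda>_. UNIV" and \<kappa> = "\<lambda>_ _ _. 0"])
    show "transforms UNIV encode_list (\<lambda>x. encode_list []) (\<lambda>_. 0)"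
      by (rule transforms_expr[where e = EmptyE]) auto
    show "transforms UNIV encode_list (\<lambda>x. encode_list (map (\<lambda>y. y) x)) (\<lambda>_. 0)"
      by (rule transforms_expr[where e = "Var 0"]) auto
    show "transforms {(x, b, y). x \<in> UNIV \<and> b \<in> UNIV \<and> y \<in> set x}
      (\<lambda>(x, b, y). Pair (encode_list x) (Pair (encode_list b) y)) (\<lambda>(x, b, y). encode_list (y # b)) (\<lambda>(x, b, y). 0)"
      by (rule transforms_expr[where e = "PairE (Snd (Snd (Var 0))) (Fst (Snd (Var 0)))"]) auto
  qed auto
  moreover have "foldl (\<lambda>b y. y # b) [] zs = rev zs" for zs :: "val list"
    by (simp add: foldl_conv_fold rev_conv_fold)
  ultimately show ?thesis by simp
qed

text \<open>
  Accumulating the results reverses them, hence the final reversal.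
\<close>

lemma transforms_map:
  assumes list: "transforms A u (\<lambda>x. encode_list (map ey (ys x))) (\<lambda>_. 0)"
    and step: "transforms {(x, y). x \<in> A \<and> y \<in> set (ys x)}
      (\<lambda>(x, y). Pair (u x) (ey y)) (\<lambda>(x, y). ez (f x y)) (\<lambda>(x, y). \<kappa> x y)"
  shows "transforms A u (\<lambda>x. encode_list (map ez (map (f x) (ys x)))) (\<lambda>x. \<Sum>y\<leftarrow>ys x. \<kappa> x y)"
proof -
  let ?f = "\<lambda>x b y. f x y # b"
  have "transforms A u (\<lambda>x. encode_list (map ez (foldl (?f x) [] (ys x)))) (\<lambda>x. \<Sum>y\<leftarrow>ys x. \<kappa> x y)"
  proof (rule transforms_foldl[where I = "\<lambda>_. UNIV" and K = "\<lambda>x b zs. \<Sum>y\<leftarrow>zs. \<kappa> x y", OF _ list])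
    show "transforms A u (\<lambda>x. encode_list (map ez [])) (\<lambda>_. 0)"
      by (rule transforms_expr[where e = EmptyE]) auto
    let ?S = "{(x, b, y). x \<in> A \<and> b \<in> UNIV \<and> y \<in> set (ys x)}"
    let ?w = "\<lambda>(x, b, y). Pair (u x) (Pair (encode_list (map ez b)) (ey y))"
    have "transforms ?S ?w (\<lambda>(x, b, y). ez (f x y)) (\<lambda>(x, b, y). \<kappa> x y)"
      by (rule transforms_call[OF step, where h = "\<lambda>(x, b, y). (x, y)"
            and e = "PairE (Fst (Var 0)) (Snd (Snd (Var 0)))"]) auto
    moreover have "transforms ?S ?w (\<lambda>(x, b, y). encode_list (map ez b)) (\<lambda>_. 0)"
      by (rule transforms_expr[where e = "Fst (Snd (Var 0))"]) auto
    ultimately show "transforms ?S ?w (\<lambda>(x, b, y). encode_list (map ez (f x y # b))) (\<lambda>(x, b, y). \<kappa> x y)"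
      by (rule transforms_weaken[OF transforms_pair]) auto
  qed auto
  moreover have "transforms A (\<lambda>x. encode_list (map ez (foldl (?f x) [] (ys x))))
      (\<lambda>x. encode_list (map ez (map (f x) (ys x)))) (\<lambda>_. 0)"
  proof (rule transforms_reindex[OF transforms_rev, where h = "\<lambda>x. map ez (foldl (?f x) [] (ys x))"])
    have *: "foldl (\<lambda>b y. g y # b) bs zs = rev (map g zs) @ bs" for g :: "'b \<Rightarrow> 'c" and bs zs
      by (induction zs arbitrary: bs) auto
    show "map ez (foldl (?f x) [] (ys x)) \<in> UNIV \<and>
      encode_list (map ez (foldl (?f x) [] (ys x))) = encode_list (map ez (foldl (?f x) [] (ys x))) \<and>
      encode_list (map ez (map (f x) (ys x))) = encode_list (rev (map ez (foldl (?f x) [] (ys x)))) \<and> (0::nat) \<le> 0"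
      for x
      by (simp add: * rev_map)
  qed
  ultimately show ?thesis using transforms_seq by fastforce
qed

lemma transforms_ball:
  assumes list: "transforms A u (\<lambda>x. encode_list (map ey (ys x))) (\<lambda>_. 0)"
    and step: "transforms {(x, y). x \<in> A \<and> y \<in> set (ys x)}
      (\<lambda>(x, y). Pair (u x) (ey y)) (\<lambda>(x, y). bool_val (P x y)) (\<lambda>(x, y). \<kappa> x y)"
  shows "transforms A u (\<lambda>x. bool_val (\<forall>y\<in>set (ys x). P x y)) (\<lambda>x. \<Sum>y\<leftarrow>ys x. \<kappa> x y)"
proof -
  let ?f = "\<lambda>x b y. b \<and> P x y"
  have "transforms A u (\<lambda>x. bool_val (foldl (?f x) True (ys x))) (\<lambda>x. \<Sum>y\<leftarrow>ys x. \<kappa> x y)"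
  proof (rule transforms_foldl[where I = "\<lambda>_. UNIV" and K = "\<lambda>x b zs. \<Sum>y\<leftarrow>zs. \<kappa> x y", OF _ list])
    show "transforms A u (\<lambda>x. bool_val True) (\<lambda>_. 0)"
      by (rule transforms_expr[where e = "Lit 1"]) (auto simp: bool_val_def)
    let ?S = "{(x, b, y). x \<in> A \<and> b \<in> UNIV \<and> y \<in> set (ys x)}"
    let ?w = "\<lambda>(x, b, y). Pair (u x) (Pair (bool_val b) (ey y))"
    have p: "transforms ?S ?w (\<lambda>q. bool_val ((\<lambda>(x, b, y). P x y) q)) (\<lambda>(x, b, y). \<kappa> x y)"
      by (rule transforms_call[OF step, where h = "\<lambda>(x, b, y). (x, y)"
            and e = "PairE (Fst (Var 0)) (Snd (Snd (Var 0)))"]) auto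
    have b: "transforms ?S ?w (\<lambda>q. bool_val ((\<lambda>(x, b, y). b) q)) (\<lambda>_. 0)"
      by (rule transforms_expr[where e = "Fst (Snd (Var 0))"]) auto
    show "transforms ?S ?w (\<lambda>(x, b, y). bool_val (b \<and> P x y)) (\<lambda>(x, b, y). \<kappa> x y)"
      by (rule transforms_weaken[OF transforms_conj[OF b p]]) auto
  qed auto
  moreover have "foldl (?f x) b zs \<longleftrightarrow> b \<and> (\<forall>y\<in>set zs. P x y)" for x b zs
    by (induction zs arbitrary: b) auto
  ultimately show ?thesis by simp
qed

lemma transforms_bex:
  assumes list: "transforms A u (\<lambda>x. encode_list (map ey (ys x))) (\<lambda>_. 0)"
    and step: "transforms {(x, y). x \<in> A \<and> y \<in> set (ys x)}
      (\<lambda>(x, y). Pair (u x) (ey y)) (\<lambda>(x, y). bool_val (P x y)) (\<lambda>(x, y). \<kappa> x y)"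
  shows "transforms A u (\<lambda>x. bool_val (\<exists>y\<in>set (ys x). P x y)) (\<lambda>x. \<Sum>y\<leftarrow>ys x. \<kappa> x y)"
proof -
  let ?S = "{(x, y). x \<in> A \<and> y \<in> set (ys x)}" and ?w = "\<lambda>(x, y). Pair (u x) (ey y)"
  have "transforms ?S ?w (\<lambda>q. bool_val (case q of (x, y) \<Rightarrow> P x y)) (\<lambda>(x, y). \<kappa> x y)"
    by (rule transforms_weaken[OF step]) auto
  then have "transforms ?S ?w (\<lambda>q. bool_val (\<not> (case q of (x, y) \<Rightarrow> P x y))) (\<lambda>(x, y). \<kappa> x y)"
    by (rule transforms_not)
  then have "transforms ?S ?w (\<lambda>(x, y). bool_val (\<not> P x y)) (\<lambda>(x, y). \<kappa> x y)"
    by (rule transforms_weaken) auto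
  from transforms_not[OF transforms_ball[OF list this]] show ?thesis by simp
qed


section \<open>Evaluating polynomials\<close>

lemma expr_val_Snd_funpow: "expr_val ((Snd ^^ j) e) s = (val_snd ^^ j) (expr_val e s)"
  by (induction j) auto

lemma expr_cost_Snd_funpow: "expr_cost ((Snd ^^ j) e) = expr_cost e"
  by (induction j) auto

lemma encode_point_nth: "j < length a \<Longrightarrow> val_fst ((val_snd ^^ j) (encode_point a)) = IntV (a ! j)"
proof (induction j arbitrary: a)
  case 0
  then show ?case by (cases a) (auto simp: encode_point_def)
next
  case (Suc j)
  then obtain b a' where "a = b # a'" by (cases a) auto
  then show ?case using Suc by (simp add: funpow_swap1 encode_point_def)
qed

text \<open>
  As \<open>n\<close> is fixed, the program may compare the index with each \<open>j < n\<close> in turn; counting down would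
  cost arithmetic operations.
\<close>

lemma transforms_nth:
  "transforms {(a, i). length a = n \<and> i < n}
     (\<lambda>(a, i). Pair (encode_point a) (IntV (int i))) (\<lambda>(a, i). IntV (a ! i)) (\<lambda>_. 0)"
proof -
  have "transforms {(a, i). i < length a \<and> i < j}
     (\<lambda>(a, i). Pair (encode_point a) (IntV (int i))) (\<lambda>(a, i). IntV (a ! i)) (\<lambda>_. 0)" for j
  proof (induction j)
    case 0
    show ?case by (rule transforms_expr[where e = EmptyE]) auto
  next
    case (Suc j)
    show ?case
    proof (rule transforms_if_test[where b = "EqInt (Snd (Var 0)) (Lit (int j))" and P = "\<lambda>(a, i). i = j"])
      show "transforms {x \<in> {(a, i). i < length a \<and> i < Suc j}. (\<lambda>(a, i). i = j) x}
          (\<lambda>(a, i). Pair (encode_point a) (IntV (int i))) (\<lambda>(a, i). IntV (a ! i)) (\<lambda>_. 0)"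
        by (rule transforms_expr[where e = "Fst ((Snd ^^ j) (Fst (Var 0)))"])
           (auto simp: expr_val_Snd_funpow expr_cost_Snd_funpow encode_point_nth)
      show "transforms {x \<in> {(a, i). i < length a \<and> i < Suc j}. \<not> (\<lambda>(a, i). i = j) x}
          (\<lambda>(a, i). Pair (encode_point a) (IntV (int i))) (\<lambda>(a, i). IntV (a ! i)) (\<lambda>_. 0)"
        by (rule transforms_weaken[OF Suc]) auto
    qed auto
  qed
  from this[of n] show ?thesis by (rule transforms_weaken) auto
qed

text \<open>
  Expressions are evaluated by a stack machine. Its state consists of the point, a stack of tasks and a
  stack of values; \<open>AddTop\<close> and \<open>MulTop\<close> combine the two topmost values. Their codes use the tags \<open>4\<close>
  and \<open>5\<close>, which continue those of \<open>encode_pexp\<close>.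
\<close>

datatype task = Eval pexp | AddTop | MulTop

fun encode_task :: "task \<Rightarrow> val" where
  "encode_task (Eval e) = encode_pexp e"
| "encode_task AddTop = Pair (IntV 4) Empty"
| "encode_task MulTop = Pair (IntV 5) Empty"

text \<open>
  With \<open>d\<close> values on the stack, no task will find fewer than two values when it needs them.
\<close>

fun tasks_ok :: "nat \<Rightarrow> nat \<Rightarrow> task list \<Rightarrow> bool" where
  "tasks_ok n d [] = True"
| "tasks_ok n d (Eval e # ts) = (pexp_vars e \<subseteq> {..<n} \<and> tasks_ok n (Suc d) ts)"
| "tasks_ok n d (AddTop # ts) = (2 \<le> d \<and> tasks_ok n (d - 1) ts)"
| "tasks_ok n d (MulTop # ts) = (2 \<le> d \<and> tasks_ok n (d - 1) ts)"

fun run_tasks :: "int list \<Rightarrow> task list \<Rightarrow> int list \<Rightarrow> int list" where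
  "run_tasks a [] vs = vs"
| "run_tasks a (Eval e # ts) vs = run_tasks a ts (pexp_eval a e # vs)"
| "run_tasks a (AddTop # ts) vs = run_tasks a ts ((vs ! 1 + vs ! 0) # drop 2 vs)"
| "run_tasks a (MulTop # ts) vs = run_tasks a ts ((vs ! 1 * vs ! 0) # drop 2 vs)"

fun tasks_ops :: "task list \<Rightarrow> nat" where
  "tasks_ops [] = 0"
| "tasks_ops (Eval e # ts) = pexp_ops e + tasks_ops ts"
| "tasks_ops (AddTop # ts) = Suc (tasks_ops ts)"
| "tasks_ops (MulTop # ts) = Suc (tasks_ops ts)"

text \<open>
  A sum or product is replaced by three tasks, two of them for its arguments, and the weight decreases.
\<close>

fun pexp_weight :: "pexp \<Rightarrow> nat" where
  "pexp_weight (PConst c) = 1"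
| "pexp_weight (PVar i) = 1"
| "pexp_weight (PAdd p q) = 2 + pexp_weight p + pexp_weight q"
| "pexp_weight (PMul p q) = 2 + pexp_weight p + pexp_weight q"

fun tasks_weight :: "task list \<Rightarrow> nat" where
  "tasks_weight [] = 0"
| "tasks_weight (Eval e # ts) = pexp_weight e + tasks_weight ts"
| "tasks_weight (AddTop # ts) = Suc (tasks_weight ts)"
| "tasks_weight (MulTop # ts) = Suc (tasks_weight ts)"

fun task_step :: "int list \<times> task list \<times> int list \<Rightarrow> int list \<times> task list \<times> int list" where
  "task_step (a, Eval (PConst c) # ts, vs) = (a, ts, c # vs)"
| "task_step (a, Eval (PVar i) # ts, vs) = (a, ts, a ! i # vs)"
| "task_step (a, Eval (PAdd p q) # ts, vs) = (a, Eval p # Eval q # AddTop # ts, vs)"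
| "task_step (a, Eval (PMul p q) # ts, vs) = (a, Eval p # Eval q # MulTop # ts, vs)"
| "task_step (a, AddTop # ts, vs) = (a, ts, (vs ! 1 + vs ! 0) # drop 2 vs)"
| "task_step (a, MulTop # ts, vs) = (a, ts, (vs ! 1 * vs ! 0) # drop 2 vs)"
| "task_step (a, [], vs) = (a, [], vs)"

fun task_tag :: "task \<Rightarrow> int" where
  "task_tag (Eval (PConst c)) = 0"
| "task_tag (Eval (PVar i)) = 1"
| "task_tag (Eval (PAdd p q)) = 2"
| "task_tag (Eval (PMul p q)) = 3"
| "task_tag AddTop = 4"
| "task_tag MulTop = 5"

lemma val_fst_encode_task: "val_fst (encode_task t) = IntV (task_tag t)"
  by (cases t rule: task_tag.cases) auto

definition machine_states :: "nat \<Rightarrow> (int list \<times> task list \<times> int list) set" where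
  "machine_states n = {(a, ts, vs). length a = n \<and> tasks_ok n (length vs) ts}"

fun encode_state :: "int list \<times> task list \<times> int list \<Rightarrow> val" where
  "encode_state (a, ts, vs) =
     Pair (encode_point a) (Pair (encode_list (map encode_task ts)) (encode_list (map IntV vs)))"

fun step_ops :: "int list \<times> task list \<times> int list \<Rightarrow> nat" where
  "step_ops (a, ts, vs) = (if ts \<noteq> [] \<and> task_tag (hd ts) \<ge> 4 then 1 else 0)"

lemma transforms_tag_split:
  assumes "\<And>x. x \<in> B \<Longrightarrow> fst (snd x) \<noteq> []"
    and "transforms {x \<in> B. task_tag (hd (fst (snd x))) = j} encode_state v \<kappa>"
    and "transforms {x \<in> B. task_tag (hd (fst (snd x))) \<noteq> j} encode_state v \<kappa>"
  shows "transforms B encode_state v \<kappa>"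
proof (rule transforms_if_test[OF _ _ assms(2,3)])
  show "test_val (EqInt (Fst (Fst (Fst (Snd (Var 0))))) (Lit j)) s = (task_tag (hd (fst (snd x))) = j)"
    if "x \<in> B" "s 0 = encode_state x" for x s
    using that assms(1)[OF that(1)] by (cases x) (auto simp: neq_Nil_conv val_fst_encode_task)
qed auto

text \<open>
  The machine distinguishes the six kinds of tasks by their tags, one after the other. Only the
  last two perform an operation.
\<close>

lemma transforms_task_step:
  "transforms {x \<in> machine_states n. fst (snd x) \<noteq> []} encode_state
     (\<lambda>x. encode_state (task_step x)) step_ops"
proof -
  let ?A = "{x \<in> machine_states n. fst (snd x) \<noteq> []}"
  let ?T = "\<lambda>x. task_tag (hd (fst (snd x)))"
  let ?task = "Fst (Fst (Snd (Var 0)))" and ?rest = "Snd (Fst (Snd (Var 0)))"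
    and ?vals = "Snd (Snd (Var 0))" and ?point = "Fst (Var 0)"
  have const: "transforms {x \<in> ?A. ?T x = 0} encode_state (\<lambda>x. encode_state (task_step x)) step_ops"
    by (rule transforms_expr[where e = "PairE ?point (PairE ?rest (PairE (Snd ?task) ?vals))"])
       (auto simp: neq_Nil_conv elim!: task_tag.elims)
  have var: "transforms {x \<in> ?A. ?T x = 1} encode_state (\<lambda>x. encode_state (task_step x)) step_ops"
  proof -
    let ?B = "{x \<in> ?A. ?T x = 1}"
    let ?i = "\<lambda>x. case hd (fst (snd x)) of Eval (PVar i) \<Rightarrow> i | _ \<Rightarrow> 0"
    have 1: "transforms ?B encode_state (\<lambda>x. encode_point (fst x)) (\<lambda>_. 0)"
      by (rule transforms_expr[where e = ?point]) auto
    have 2: "transforms ?B encode_state (\<lambda>x. encode_list (map encode_task (tl (fst (snd x))))) (\<lambda>_. 0)"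
      by (rule transforms_expr[where e = ?rest]) (auto simp: neq_Nil_conv)
    have 3: "transforms ?B encode_state (\<lambda>x. IntV (fst x ! ?i x)) (\<lambda>_. 0)"
      by (rule transforms_call[OF transforms_nth[of n], where e = "PairE ?point (Snd ?task)" and h = "\<lambda>x. (fst x, ?i x)"])
         (auto simp: neq_Nil_conv machine_states_def elim!: task_tag.elims)
    have 4: "transforms ?B encode_state (\<lambda>x. encode_list (map IntV (snd (snd x)))) (\<lambda>_. 0)"
      by (rule transforms_expr[where e = ?vals]) auto
    show ?thesis
      by (rule transforms_weaken[OF transforms_pair[OF 1 transforms_pair[OF 2 transforms_pair[OF 3 4]]]])
         (auto simp: neq_Nil_conv elim!: task_tag.elims)
  qed
  have add: "transforms {x \<in> ?A. ?T x = 2} encode_state (\<lambda>x. encode_state (task_step x)) step_ops"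
    by (rule transforms_expr[where e = "PairE ?point (PairE (PairE (Fst (Snd ?task)) (PairE (Snd (Snd ?task))
          (PairE (PairE (Lit 4) EmptyE) ?rest))) ?vals)"])
       (auto simp: neq_Nil_conv elim!: task_tag.elims)
  have mul: "transforms {x \<in> ?A. ?T x = 3} encode_state (\<lambda>x. encode_state (task_step x)) step_ops"
    by (rule transforms_expr[where e = "PairE ?point (PairE (PairE (Fst (Snd ?task)) (PairE (Snd (Snd ?task))
          (PairE (PairE (Lit 5) EmptyE) ?rest))) ?vals)"])
       (auto simp: neq_Nil_conv elim!: task_tag.elims)
  have two: "\<exists>v w us. vs = v # w # us" if "2 \<le> length vs" for vs :: "int list"
    using that by (cases vs; cases "tl vs") auto
  have addtop: "transforms {x \<in> ?A. ?T x = 4} encode_state (\<lambda>x. encode_state (task_step x)) step_ops"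
    by (rule transforms_expr[where e = "PairE ?point (PairE ?rest (PairE (Plus (Fst (Snd ?vals)) (Fst ?vals)) (Snd (Snd ?vals))))"])
       (auto simp: neq_Nil_conv machine_states_def elim!: task_tag.elims dest!: two)
  have multop: "transforms {x \<in> ?A. ?T x = 5} encode_state (\<lambda>x. encode_state (task_step x)) step_ops"
    by (rule transforms_expr[where e = "PairE ?point (PairE ?rest (PairE (Times (Fst (Snd ?vals)) (Fst ?vals)) (Snd (Snd ?vals))))"])
       (auto simp: neq_Nil_conv machine_states_def elim!: task_tag.elims dest!: two)
  have tags: "task_tag t \<in> {0, 1, 2, 3, 4, 5}" for t by (cases t rule: task_tag.cases) auto
  note sub = transforms_weaken[OF _ _ refl order_refl]
  show ?thesis
    apply (rule transforms_tag_split[where j = 0], blast, rule const)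
    apply (rule transforms_tag_split[where j = 1], blast, rule sub[OF var], blast)
    apply (rule transforms_tag_split[where j = 2], blast, rule sub[OF add], blast)
    apply (rule transforms_tag_split[where j = 3], blast, rule sub[OF mul], blast)
    apply (rule transforms_tag_split[where j = 4], blast, rule sub[OF addtop], blast)
    apply (rule sub[OF multop])
    using tags by blast
qed

lemma transforms_pexp_eval:
  "transforms {(a, e). length a = n \<and> pexp_vars e \<subseteq> {..<n}}
     (\<lambda>(a, e). Pair (encode_point a) (encode_pexp e)) (\<lambda>(a, e). IntV (pexp_eval a e)) (\<lambda>(a, e). pexp_ops e)"
proof -
  let ?v = "\<lambda>(a, ts, vs). encode_state (a, [], run_tasks a ts vs)"
  have loop: "transforms (machine_states n) encode_state ?v (\<lambda>(a, ts, vs). tasks_ops ts)"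
  proof (rule transforms_while[where b = "IsPair (Fst (Snd (Var 0)))" and P = "\<lambda>x. fst (snd x) \<noteq> []",
        OF _ _ transforms_task_step, where m = "\<lambda>(a, ts, vs). tasks_weight ts"])
    fix x :: "int list \<times> task list \<times> int list"
    obtain a ts vs where x: "x = (a, ts, vs)" by (cases x)
    show "test_val (IsPair (Fst (Snd (Var 0)))) s = (fst (snd x) \<noteq> [])" if "s 0 = encode_state x" for s
      using that x by (cases ts) auto
    assume A: "x \<in> machine_states n"
    show "?v x = encode_state x" if "\<not> fst (snd x) \<noteq> []"
      using that x by simp
    assume "fst (snd x) \<noteq> []"
    then obtain t ts' where ts: "ts = t # ts'" using x by (auto simp: neq_Nil_conv)
    show "task_step x \<in> machine_states n"
      using A unfolding x ts machine_states_def by (cases t rule: task_tag.cases) (auto simp: numeral_2_eq_2 Suc_diff_Suc)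
    show "(\<lambda>(a, ts, vs). tasks_weight ts) (task_step x) < (\<lambda>(a, ts, vs). tasks_weight ts) x"
      unfolding x ts by (cases t rule: task_tag.cases) auto
    show "?v (task_step x) = ?v x"
      unfolding x ts by (cases t rule: task_tag.cases) auto
    show "step_ops x + (\<lambda>(a, ts, vs). tasks_ops ts) (task_step x) \<le> (\<lambda>(a, ts, vs). tasks_ops ts) x"
      unfolding x ts by (cases t rule: task_tag.cases) auto
  qed auto
  let ?A = "{(a, e). length a = n \<and> pexp_vars e \<subseteq> {..<n}}"
  let ?h = "\<lambda>(a, e). (a, [Eval e], [])"
  have "transforms ?A (\<lambda>(a, e). Pair (encode_point a) (encode_pexp e)) (\<lambda>x. ?v (?h x)) (\<lambda>(a, e). pexp_ops e)"
    by (rule transforms_call[OF loop, where h = ?h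
          and e = "PairE (Fst (Var 0)) (PairE (PairE (Snd (Var 0)) EmptyE) EmptyE)"])
       (auto simp: machine_states_def)
  moreover have "transforms ?A (\<lambda>x. ?v (?h x)) (\<lambda>(a, e). IntV (pexp_eval a e)) (\<lambda>_. 0)"
    by (rule transforms_expr[where e = "Fst (Snd (Snd (Var 0)))"]) auto
  ultimately show ?thesis using transforms_seq by fastforce
qed

section \<open>Points and lists of points\<close>

definition encode_tuple :: "pexp list \<Rightarrow> val" where
  "encode_tuple es = encode_list (map encode_pexp es)"

definition encode_points :: "int list list \<Rightarrow> val" where
  "encode_points L = encode_list (map encode_point L)"

definition tuple_ops :: "pexp list \<Rightarrow> nat" where
  "tuple_ops es = (\<Sum>e\<leftarrow>es. pexp_ops e)"

lemma transforms_pexp_map: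
  "transforms (int_points n \<times> pexp_tuples n) (\<lambda>(a, es). Pair (encode_point a) (encode_tuple es))
     (\<lambda>(a, es). encode_point (pexp_map es a)) (\<lambda>(a, es). tuple_ops es)"
proof -
  let ?A = "int_points n \<times> pexp_tuples n"
  let ?u = "\<lambda>(a, es). Pair (encode_point a) (encode_tuple es)"
  have "transforms ?A ?u (\<lambda>x. encode_list (map IntV (map (pexp_eval (fst x)) (snd x))))
      (\<lambda>x. \<Sum>e\<leftarrow>snd x. pexp_ops e)"
  proof (rule transforms_map)
    show "transforms ?A ?u (\<lambda>x. encode_list (map encode_pexp (snd x))) (\<lambda>_. 0)"
      by (rule transforms_expr[where e = "Snd (Var 0)"]) (auto simp: encode_tuple_def)
    show "transforms {(x, y). x \<in> ?A \<and> y \<in> set (snd x)} (\<lambda>(x, y). Pair (?u x) (encode_pexp y))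
        (\<lambda>(x, y). IntV (pexp_eval (fst x) y)) (\<lambda>(x, e). pexp_ops e)"
      by (rule transforms_call[OF transforms_pexp_eval[of n], where h = "\<lambda>(x, e). (fst x, e)"
            and e = "PairE (Fst (Fst (Var 0))) (Snd (Var 0))"])
         (auto simp: int_points_def pexp_tuples_def)
  qed
  then show ?thesis
    by (rule transforms_weaken) (auto simp: encode_point_def pexp_map_def tuple_ops_def)
qed

lemma transforms_point_eq:
  "transforms (int_points n \<times> int_points n) (\<lambda>(a, b). Pair (encode_point a) (encode_point b))
     (\<lambda>(a, b). bool_val (a = b)) (\<lambda>_. 0)"
proof -
  let ?A = "int_points n \<times> int_points n"
  let ?u = "\<lambda>(a, b). Pair (encode_point a) (encode_point b)"
  have "j \<le> n \<Longrightarrow> transforms ?A ?u (\<lambda>x. bool_val (\<forall>i<j. fst x ! i = snd x ! i)) (\<lambda>_. 0)" for j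
  proof (induction j)
    case 0
    show ?case by (rule transforms_expr[where e = "Lit 1"]) (auto simp: bool_val_def)
  next
    case (Suc j)
    have "transforms ?A ?u (\<lambda>x. bool_val (fst x ! j = snd x ! j)) (\<lambda>_. 0)"
      by (rule transforms_test[where b = "EqInt (Fst ((Snd ^^ j) (Fst (Var 0)))) (Fst ((Snd ^^ j) (Snd (Var 0))))"])
         (use Suc.prems in \<open>auto simp: expr_val_Snd_funpow expr_cost_Snd_funpow encode_point_nth int_points_def\<close>)
    from transforms_conj[OF this Suc.IH] Suc.prems show ?case
      by (simp add: All_less_Suc conj_commute)
  qed
  from this[of n, OF order_refl] show ?thesis
    by (rule transforms_weaken) (auto simp: int_points_def list_eq_iff_nth_eq)
qed

lemma transforms_point_member:
  "transforms {(p, L). p \<in> int_points n \<and> set L \<subseteq> int_points n}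
     (\<lambda>(p, L). Pair (encode_point p) (encode_points L)) (\<lambda>(p, L). bool_val (p \<in> set L)) (\<lambda>_. 0)"
proof -
  let ?A = "{(p, L). p \<in> int_points n \<and> set L \<subseteq> int_points n}"
  let ?u = "\<lambda>(p, L). Pair (encode_point p) (encode_points L)"
  have "transforms ?A ?u (\<lambda>x. bool_val (\<exists>q\<in>set (snd x). fst x = q)) (\<lambda>x. \<Sum>q\<leftarrow>snd x. 0)"
  proof (rule transforms_bex)
    show "transforms ?A ?u (\<lambda>x. encode_list (map encode_point (snd x))) (\<lambda>_. 0)"
      by (rule transforms_expr[where e = "Snd (Var 0)"]) (auto simp: encode_points_def)
    show "transforms {(x, y). x \<in> ?A \<and> y \<in> set (snd x)} (\<lambda>(x, y). Pair (?u x) (encode_point y))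
        (\<lambda>(x, y). bool_val (fst x = y)) (\<lambda>(x, y). 0)"
      by (rule transforms_call[OF transforms_point_eq[of n], where h = "\<lambda>(x, q). (fst x, q)"
            and e = "PairE (Fst (Fst (Var 0))) (Snd (Var 0))"]) auto
  qed
  then show ?thesis by (rule transforms_weaken) auto
qed

lemma transforms_points_subset:
  "transforms {(L, M). set L \<subseteq> int_points n \<and> set M \<subseteq> int_points n}
     (\<lambda>(L, M). Pair (encode_points L) (encode_points M)) (\<lambda>(L, M). bool_val (set L \<subseteq> set M)) (\<lambda>_. 0)"
proof -
  let ?A = "{(L, M). set L \<subseteq> int_points n \<and> set M \<subseteq> int_points n}"
  let ?u = "\<lambda>(L, M). Pair (encode_points L) (encode_points M)"
  have "transforms ?A ?u (\<lambda>x. bool_val (\<forall>p\<in>set (fst x). p \<in> set (snd x))) (\<lambda>x. \<Sum>q\<leftarrow>fst x. 0)"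
  proof (rule transforms_ball)
    show "transforms ?A ?u (\<lambda>x. encode_list (map encode_point (fst x))) (\<lambda>_. 0)"
      by (rule transforms_expr[where e = "Fst (Var 0)"]) (auto simp: encode_points_def)
    show "transforms {(x, y). x \<in> ?A \<and> y \<in> set (fst x)} (\<lambda>(x, y). Pair (?u x) (encode_point y))
        (\<lambda>(x, y). bool_val (y \<in> set (snd x))) (\<lambda>(x, y). 0)"
      by (rule transforms_call[OF transforms_point_member[of n], where h = "\<lambda>(x, q). (q, snd x)"
            and e = "PairE (Snd (Var 0)) (Snd (Fst (Var 0)))"]) auto
  qed
  then show ?thesis by (rule transforms_weaken) (auto simp: subset_eq)
qed

lemma pexp_map_int_points: "es \<in> pexp_tuples n \<Longrightarrow> pexp_map es a \<in> int_points n"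
  by (simp add: pexp_tuples_def int_points_def pexp_map_def)

lemma pexp_map_mem_int_points: "set fs \<subseteq> pexp_tuples n \<Longrightarrow> es \<in> set fs \<Longrightarrow> pexp_map es a \<in> int_points n"
  using pexp_map_int_points by blast

lemma transforms_images:
  "transforms {(L, es). set L \<subseteq> int_points n \<and> es \<in> pexp_tuples n}
     (\<lambda>(L, es). Pair (encode_points L) (encode_tuple es))
     (\<lambda>(L, es). encode_points (map (pexp_map es) L)) (\<lambda>(L, es). length L * tuple_ops es)"
proof -
  let ?A = "{(L, es). set L \<subseteq> int_points n \<and> es \<in> pexp_tuples n}"
  let ?u = "\<lambda>(L, es). Pair (encode_points L) (encode_tuple es)"
  have "transforms ?A ?u (\<lambda>x. encode_list (map encode_point (map (pexp_map (snd x)) (fst x))))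
      (\<lambda>x. \<Sum>p\<leftarrow>fst x. tuple_ops (snd x))"
  proof (rule transforms_map)
    show "transforms ?A ?u (\<lambda>x. encode_list (map encode_point (fst x))) (\<lambda>_. 0)"
      by (rule transforms_expr[where e = "Fst (Var 0)"]) (auto simp: encode_points_def)
    show "transforms {(x, y). x \<in> ?A \<and> y \<in> set (fst x)} (\<lambda>(x, y). Pair (?u x) (encode_point y))
        (\<lambda>(x, y). encode_point (pexp_map (snd x) y)) (\<lambda>(x, y). tuple_ops (snd x))"
      by (rule transforms_call[OF transforms_pexp_map[of n], where h = "\<lambda>(x, p). (p, snd x)"
            and e = "PairE (Snd (Var 0)) (Snd (Fst (Var 0)))"]) auto
  qed
  then show ?thesis
    by (rule transforms_weaken) (auto simp: encode_points_def sum_list_triv)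
qed

section \<open>The search for the orbit\<close>

definition encode_tuples :: "pexp list list \<Rightarrow> val" where
  "encode_tuples fs = encode_list (map encode_tuple fs)"

definition search_states :: "nat \<Rightarrow> (int list list \<times> pexp list list) set" where
  "search_states n = {(L, fs). L \<noteq> [] \<and> set L \<subseteq> int_points n \<and> set fs \<subseteq> pexp_tuples n}"

fun encode_search :: "int list list \<times> pexp list list \<Rightarrow> val" where
  "encode_search (L, fs) = Pair (encode_points L) (encode_tuples fs)"

lemma total_ops_tuple_ops: "total_ops fs = (\<Sum>es\<leftarrow>fs. tuple_ops es)"
  by (simp add: total_ops_def tuple_ops_def)

lemma transforms_permutation_check:
  "transforms (search_states n) encode_search
     (\<lambda>(L, fs). bool_val (\<forall>es\<in>set fs. pexp_map es ` set L = set L))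
     (\<lambda>(L, fs). length L * total_ops fs)"
proof -
  let ?A = "search_states n"
  have "transforms ?A encode_search (\<lambda>x. bool_val (\<forall>es\<in>set (snd x). pexp_map es ` set (fst x) = set (fst x)))
      (\<lambda>x. \<Sum>es\<leftarrow>snd x. length (fst x) * tuple_ops es)"
  proof (rule transforms_ball)
    show "transforms ?A encode_search (\<lambda>x. encode_list (map encode_tuple (snd x))) (\<lambda>_. 0)"
      by (rule transforms_expr[where e = "Snd (Var 0)"]) (auto simp: encode_tuples_def)
    let ?B = "{(x, es). x \<in> ?A \<and> es \<in> set (snd x)}"
    let ?u = "\<lambda>(x, es). Pair (encode_search x) (encode_tuple es)"
    let ?M = "\<lambda>x. map (pexp_map (snd x)) (fst (fst x))"
    have 1: "transforms ?B ?u (\<lambda>x. encode_points (fst (fst x))) (\<lambda>_. 0)"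
      by (rule transforms_expr[where e = "Fst (Fst (Var 0))"]) auto
    have 2: "transforms ?B ?u (\<lambda>x. encode_points (?M x)) (\<lambda>x. length (fst (fst x)) * tuple_ops (snd x))"
      by (rule transforms_call[OF transforms_images[of n], where h = "\<lambda>(x, es). (fst x, es)"
            and e = "PairE (Fst (Fst (Var 0))) (Snd (Var 0))"])
         (auto simp: search_states_def)
    let ?w = "\<lambda>x. Pair (encode_points (fst (fst x))) (encode_points (?M x))"
    have 3: "transforms ?B ?w (\<lambda>x. bool_val (set (fst (fst x)) \<subseteq> set (?M x))) (\<lambda>_. 0)"
      by (rule transforms_call[OF transforms_points_subset[of n], where h = "\<lambda>x. (fst (fst x), ?M x)"
            and e = "Var 0"])
         (auto simp: search_states_def intro: pexp_map_mem_int_points)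
    have 4: "transforms ?B ?w (\<lambda>x. bool_val (set (?M x) \<subseteq> set (fst (fst x)))) (\<lambda>_. 0)"
      by (rule transforms_call[OF transforms_points_subset[of n], where h = "\<lambda>x. (?M x, fst (fst x))"
            and e = "PairE (Snd (Var 0)) (Fst (Var 0))"])
         (auto simp: search_states_def intro: pexp_map_mem_int_points)
    show "transforms ?B ?u (\<lambda>(x, es). bool_val (pexp_map es ` set (fst x) = set (fst x)))
        (\<lambda>(x, es). length (fst x) * tuple_ops es)"
      by (rule transforms_weaken[OF transforms_seq[OF transforms_pair[OF 1 2] transforms_conj[OF 3 4]]])
         (simp_all add: case_prod_beta set_eq_subset conj_commute)
  qed
  then show ?thesis
    by (rule transforms_weaken) (auto simp: total_ops_tuple_ops sum_list_const_mult)
qed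

text \<open>
  The candidate \<open>c\<close> is replaced as long as it is already in \<open>L\<close>. Beginning with a member of \<open>L\<close>, the
  result is outside \<open>L\<close> if and only if some element of the second list is; this avoids a separate
  value for failure.
\<close>

definition escape :: "'a list \<Rightarrow> 'a \<Rightarrow> 'a list \<Rightarrow> 'a" where
  "escape L = foldl (\<lambda>c p. if c \<in> set L then p else c)"

text \<open>
  An image under one of the maps that is new to \<open>L\<close>, and a member of \<open>L\<close> if all images are in \<open>L\<close>.
\<close>

definition candidate :: "(int list list \<times> pexp list list) \<Rightarrow> int list" where
  "candidate = (\<lambda>(L, fs). foldl (\<lambda>c es. escape L c (map (pexp_map es) L)) (hd L) fs)"

text \<open>
  Adding a single point per round keeps the list at \<open>N + 1\<close> points after \<open>N\<close> rounds. Adding all new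
  images at once would let its length depend on the number of maps, which the number of operations in
  the input does not bound: maps such as constants contain no operation at all.
\<close>

definition grow :: "(int list list \<times> pexp list list) \<Rightarrow> int list list" where
  "grow x = (if candidate x \<in> set (fst x) then fst x else candidate x # fst x)"

lemma escape_in_iff: "escape L c ps \<in> set L \<longleftrightarrow> c \<in> set L \<and> set ps \<subseteq> set L"
  unfolding escape_def by (induction ps arbitrary: c) auto

lemma escape_cases: "escape L c ps \<in> insert c (set ps)"
  unfolding escape_def
proof (induction ps arbitrary: c)
  case (Cons p ps)
  show ?case using Cons[of "if c \<in> set L then p else c"] by (auto split: if_splits)
qed simp

lemma candidate_in_iff:
  assumes "L \<noteq> []"
  shows "candidate (L, fs) \<in> set L \<longleftrightarrow> (\<forall>es\<in>set fs. pexp_map es ` set L \<subseteq> set L)"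
proof -
  have "foldl (\<lambda>c es. escape L c (map (pexp_map es) L)) c fs \<in> set L \<longleftrightarrow>
      c \<in> set L \<and> (\<forall>es\<in>set fs. pexp_map es ` set L \<subseteq> set L)" for c
    by (induction fs arbitrary: c) (auto simp: escape_in_iff)
  then show ?thesis using assms by (simp add: candidate_def)
qed

lemma candidate_cases:
  assumes "L \<noteq> []"
  shows "candidate (L, fs) \<in> set L \<or> (\<exists>es\<in>set fs. candidate (L, fs) \<in> pexp_map es ` set L)"
proof -
  have "foldl (\<lambda>c es. escape L c (map (pexp_map es) L)) c fs = c \<or>
      (\<exists>es\<in>set fs. foldl (\<lambda>c es. escape L c (map (pexp_map es) L)) c fs \<in> pexp_map es ` set L)" for c
  proof (induction fs arbitrary: c)
    case (Cons es fs)
    let ?c = "escape L c (map (pexp_map es) L)"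
    have "?c = c \<or> ?c \<in> pexp_map es ` set L" using escape_cases[of L c "map (pexp_map es) L"] by simp
    then show ?case using Cons[of ?c] by (simp only: foldl_Cons list.set bex_simps) metis
  qed simp
  from this[of "hd L"] show ?thesis
    using hd_in_set[OF assms] by (auto simp only: candidate_def case_prod_conv)
qed

lemma transforms_escape:
  "transforms {(L, c, ps). set L \<subseteq> int_points n \<and> c \<in> int_points n \<and> set ps \<subseteq> int_points n}
     (\<lambda>(L, c, ps). Pair (encode_points L) (Pair (encode_point c) (encode_points ps)))
     (\<lambda>(L, c, ps). encode_point (escape L c ps)) (\<lambda>_. 0)"
proof -
  let ?A = "{(L, c, ps). set L \<subseteq> int_points n \<and> c \<in> int_points n \<and> set ps \<subseteq> int_points n}"
  let ?u = "\<lambda>(L, c, ps). Pair (encode_points L) (Pair (encode_point c) (encode_points ps))"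
  have "transforms ?A ?u
      (\<lambda>x. encode_point (foldl (\<lambda>c p. if c \<in> set (fst x) then p else c) (fst (snd x)) (snd (snd x)))) (\<lambda>_. 0)"
  proof (rule transforms_foldl[where ey = encode_point and I = "\<lambda>_. int_points n" and \<kappa> = "\<lambda>_ _ _. 0"])
    show "transforms ?A ?u (\<lambda>x. encode_point (fst (snd x))) (\<lambda>_. 0)"
      by (rule transforms_expr[where e = "Fst (Snd (Var 0))"]) auto
    show "transforms ?A ?u (\<lambda>x. encode_list (map encode_point (snd (snd x)))) (\<lambda>_. 0)"
      by (rule transforms_expr[where e = "Snd (Snd (Var 0))"]) (auto simp: encode_points_def)
    let ?B = "{(x, c, p). x \<in> ?A \<and> c \<in> int_points n \<and> p \<in> set (snd (snd x))}"
    let ?w = "\<lambda>(x, c, p). Pair (?u x) (Pair (encode_point c) (encode_point p))"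
    have 1: "transforms ?B ?w (\<lambda>y. bool_val (fst (snd y) \<in> set (fst (fst y)))) (\<lambda>_. 0)"
      by (rule transforms_call[OF transforms_point_member[of n], where h = "\<lambda>(x, c, p). (c, fst x)"
            and e = "PairE (Fst (Snd (Var 0))) (Fst (Fst (Var 0)))"]) auto
    have 2: "transforms {y \<in> ?B. fst (snd y) \<in> set (fst (fst y))} ?w
        (\<lambda>(x, c, p). encode_point (if c \<in> set (fst x) then p else c)) (\<lambda>_. 0)"
      by (rule transforms_expr[where e = "Snd (Snd (Var 0))"]) auto
    have 3: "transforms {y \<in> ?B. \<not> fst (snd y) \<in> set (fst (fst y))} ?w
        (\<lambda>(x, c, p). encode_point (if c \<in> set (fst x) then p else c)) (\<lambda>_. 0)"
      by (rule transforms_expr[where e = "Fst (Snd (Var 0))"]) auto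
    show "transforms ?B ?w (\<lambda>(x, c, p). encode_point (if c \<in> set (fst x) then p else c)) (\<lambda>(x, c, p). 0)"
      by (rule transforms_weaken[OF transforms_if[OF 1 2 3]]) auto
  qed auto
  then show ?thesis by (rule transforms_weaken) (auto simp: escape_def)
qed

lemma escape_int_points:
  "c \<in> P \<Longrightarrow> set ps \<subseteq> P \<Longrightarrow> escape L c ps \<in> P"
  using escape_cases[of L c ps] by auto

lemma transforms_candidate:
  "transforms (search_states n) encode_search (\<lambda>x. encode_point (candidate x))
     (\<lambda>(L, fs). length L * total_ops fs)"
proof -
  let ?A = "search_states n"
  have "transforms ?A encode_search
      (\<lambda>x. encode_point (foldl (\<lambda>c es. escape (fst x) c (map (pexp_map es) (fst x))) (hd (fst x)) (snd x)))
      (\<lambda>x. (\<lambda>fs. length (fst x) * total_ops fs) (snd x))"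
  proof (rule transforms_foldl[where ey = encode_tuple and I = "\<lambda>_. int_points n"
        and \<kappa> = "\<lambda>x _ es. length (fst x) * tuple_ops es"
        and K = "\<lambda>x _ fs. length (fst x) * total_ops fs"])
    show "transforms ?A encode_search (\<lambda>x. encode_point (hd (fst x))) (\<lambda>_. 0)"
      by (rule transforms_expr[where e = "Fst (Fst (Var 0))"])
         (auto simp: search_states_def encode_points_def neq_Nil_conv)
    show "transforms ?A encode_search (\<lambda>x. encode_list (map encode_tuple (snd x))) (\<lambda>_. 0)"
      by (rule transforms_expr[where e = "Snd (Var 0)"]) (auto simp: encode_tuples_def)
    let ?B = "{(x, c, es). x \<in> ?A \<and> c \<in> int_points n \<and> es \<in> set (snd x)}"
    let ?w = "\<lambda>(x, c, es). Pair (encode_search x) (Pair (encode_point c) (encode_tuple es))"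
    let ?M = "\<lambda>y. map (pexp_map (snd (snd y))) (fst (fst y))"
    have 1: "transforms ?B ?w (\<lambda>y. encode_points (fst (fst y))) (\<lambda>_. 0)"
      by (rule transforms_expr[where e = "Fst (Fst (Var 0))"]) auto
    have 2: "transforms ?B ?w (\<lambda>y. encode_point (fst (snd y))) (\<lambda>_. 0)"
      by (rule transforms_expr[where e = "Fst (Snd (Var 0))"]) auto
    have 3: "transforms ?B ?w (\<lambda>y. encode_points (?M y)) (\<lambda>y. length (fst (fst y)) * tuple_ops (snd (snd y)))"
      by (rule transforms_call[OF transforms_images[of n], where h = "\<lambda>(x, c, es). (fst x, es)"
            and e = "PairE (Fst (Fst (Var 0))) (Snd (Snd (Var 0)))"])
         (auto simp: search_states_def)
    have 4: "transforms ?B (\<lambda>y. Pair (encode_points (fst (fst y))) (Pair (encode_point (fst (snd y))) (encode_points (?M y))))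
       (\<lambda>y. encode_point (escape (fst (fst y)) (fst (snd y)) (?M y))) (\<lambda>_. 0)"
      by (rule transforms_call[OF transforms_escape[of n], where h = "\<lambda>y. (fst (fst y), fst (snd y), ?M y)"
            and e = "Var 0"])
         (auto simp: search_states_def intro: pexp_map_mem_int_points)
    show "transforms ?B ?w (\<lambda>(x, c, es). encode_point (escape (fst x) c (map (pexp_map es) (fst x))))
        (\<lambda>(x, c, es). length (fst x) * tuple_ops es)"
      by (rule transforms_weaken[OF transforms_seq[OF transforms_pair[OF 1 transforms_pair[OF 2 3]] 4]]) auto
    show "hd (fst x) \<in> int_points n" if "x \<in> ?A" for x
      using that by (auto simp: search_states_def neq_Nil_conv)
    show "escape (fst x) c (map (pexp_map es) (fst x)) \<in> int_points n"
      if "x \<in> ?A" "c \<in> int_points n" "es \<in> set (snd x)" for x c es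
      using that by (intro escape_int_points) (auto simp: search_states_def intro: pexp_map_mem_int_points)
    show "length (fst x) * tuple_ops es + length (fst x) * total_ops fs \<le> length (fst x) * total_ops (es # fs)"
      for x :: "int list list \<times> pexp list list" and es fs
      by (simp add: total_ops_tuple_ops algebra_simps)
  qed
  then show ?thesis by (rule transforms_weaken) (auto simp: candidate_def)
qed

lemma transforms_grow:
  "transforms (search_states n) encode_search (\<lambda>x. encode_points (grow x))
     (\<lambda>(L, fs). length L * total_ops fs)"
proof -
  let ?A = "search_states n"
  let ?w = "\<lambda>x. Pair (encode_point (candidate x)) (encode_points (fst x))"
  have L: "transforms ?A encode_search (\<lambda>x. encode_points (fst x)) (\<lambda>_. 0)"
    by (rule transforms_expr[where e = "Fst (Var 0)"]) auto
  have cand: "candidate x \<in> int_points n" if "x \<in> ?A" for x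
    using that candidate_cases[of "fst x" "snd x"]
    by (cases x) (auto simp: search_states_def dest: pexp_map_mem_int_points)
  have 1: "transforms ?A ?w (\<lambda>x. bool_val (candidate x \<in> set (fst x))) (\<lambda>_. 0)"
    by (rule transforms_call[OF transforms_point_member[of n], where h = "\<lambda>x. (candidate x, fst x)"
          and e = "Var 0"])
       (use cand in \<open>auto simp: search_states_def\<close>)
  have 2: "transforms {x \<in> ?A. candidate x \<in> set (fst x)} ?w (\<lambda>x. encode_points (grow x)) (\<lambda>_. 0)"
    by (rule transforms_expr[where e = "Snd (Var 0)"]) (auto simp: grow_def)
  have 3: "transforms {x \<in> ?A. \<not> candidate x \<in> set (fst x)} ?w (\<lambda>x. encode_points (grow x)) (\<lambda>_. 0)"
    by (rule transforms_expr[where e = "Var 0"]) (auto simp: grow_def encode_points_def)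
  show ?thesis
    by (rule transforms_weaken[OF transforms_seq[OF transforms_pair[OF transforms_candidate L] transforms_if[OF 1 2 3]]])
       auto
qed

definition search :: "nat \<Rightarrow> pexp list list \<Rightarrow> int list \<Rightarrow> int list list" where
  "search N fs x = ((\<lambda>L. grow (L, fs)) ^^ N) [x]"

lemma foldl_replicate_eq_funpow: "foldl (\<lambda>b _. g b) b (replicate N y) = (g ^^ N) b"
  by (induction N arbitrary: b) (auto simp: funpow_swap1)

text \<open>
  The number of rounds is written into the program in unary.
\<close>

lemma unary_literal: "\<exists>e. expr_cost e = 0 \<and> (\<forall>s. expr_val e s = encode_list (replicate N Empty))"
proof (induction N)
  case 0
  show ?case by (rule exI[of _ EmptyE]) simp
next
  case (Suc N)
  then obtain e where "expr_cost e = 0" "\<forall>s. expr_val e s = encode_list (replicate N Empty)" by blast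
  then show ?case by (intro exI[of _ "PairE EmptyE e"]) simp
qed

lemma grow_states: "(L, fs) \<in> search_states n \<Longrightarrow> (grow (L, fs), fs) \<in> search_states n"
  using candidate_cases[of L fs] by (auto simp: grow_def search_states_def dest: pexp_map_mem_int_points)

lemma length_grow: "length (grow (L, fs)) \<le> Suc (length L)"
  by (simp add: grow_def)

lemma length_search: "length (search N fs x) \<le> Suc N"
  unfolding search_def
proof (induction N)
  case (Suc N)
  then show ?case using length_grow[of "((\<lambda>L. grow (L, fs)) ^^ N) [x]" fs] by simp
qed simp

lemma search_states_search:
  assumes "x \<in> int_points n" "set fs \<subseteq> pexp_tuples n"
  shows "(search N fs x, fs) \<in> search_states n"
  unfolding search_def
proof (induction N)
  case 0
  show ?case using assms by (simp add: search_states_def)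
next
  case (Suc N)
  then show ?case using grow_states by simp
qed

text \<open>
  Each of the \<open>N\<close> rounds evaluates all maps at the at most \<open>N + 1\<close> listed points.
\<close>

lemma transforms_search:
  "transforms (int_points n \<times> lists (pexp_tuples n)) (\<lambda>(x, fs). encode_instance x fs)
     (\<lambda>(x, fs). encode_points (search N fs x)) (\<lambda>(x, fs). N * Suc N * total_ops fs)"
proof -
  let ?A = "int_points n \<times> lists (pexp_tuples n)"
  let ?u = "\<lambda>(x, fs). encode_instance x fs"
  have ui: "encode_instance x fs = Pair (encode_point x) (encode_tuples fs)" for x fs
    unfolding encode_instance_def encode_tuples_def encode_tuple_def by simp
  obtain e where e: "expr_cost e = 0" "\<forall>s. expr_val e s = encode_list (replicate N Empty)"
    using unary_literal by blast
  have "transforms ?A ?u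
      (\<lambda>x. encode_points (foldl (\<lambda>L _. grow (L, snd x)) [fst x] (replicate N Empty)))
      (\<lambda>x. (\<lambda>b zs. length zs * (length b + length zs) * total_ops (snd x)) [fst x] (replicate N Empty))"
  proof (rule transforms_foldl[where ey = "\<lambda>v. v" and I = "\<lambda>x. {L. (L, snd x) \<in> search_states n}"
        and \<kappa> = "\<lambda>x L _. length L * total_ops (snd x)"
        and K = "\<lambda>x b zs. length zs * (length b + length zs) * total_ops (snd x)"])
    show "transforms ?A ?u (\<lambda>x. encode_points [fst x]) (\<lambda>_. 0)"
      by (rule transforms_expr[where e = "PairE (Fst (Var 0)) EmptyE"]) (auto simp: ui encode_points_def)
    show "transforms ?A ?u (\<lambda>x. encode_list (map (\<lambda>v. v) (replicate N Empty))) (\<lambda>_. 0)"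
      by (rule transforms_expr[where e = e]) (auto simp: e)
    show "transforms {(x, b, y). x \<in> ?A \<and> b \<in> {L. (L, snd x) \<in> search_states n} \<and> y \<in> set (replicate N Empty)}
      (\<lambda>(x, b, y). Pair (?u x) (Pair (encode_points b) y))
      (\<lambda>(x, b, y). encode_points (grow (b, snd x))) (\<lambda>(x, b, y). length b * total_ops (snd x))"
      by (rule transforms_call[OF transforms_grow[of n], where h = "\<lambda>(x, b, y). (b, snd x)"
            and e = "PairE (Fst (Snd (Var 0))) (Snd (Fst (Var 0)))"]) (auto simp: ui)
    show "[fst x] \<in> {L. (L, snd x) \<in> search_states n}" if "x \<in> ?A" for x
      using that by (auto simp: search_states_def)
    show "grow (b, snd x) \<in> {L. (L, snd x) \<in> search_states n}"
      if "b \<in> {L. (L, snd x) \<in> search_states n}" for x :: "int list \<times> pexp list list" and b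
      using that grow_states by auto
    show "length b * total_ops (snd x) + length zs * (length (grow (b, snd x)) + length zs) * total_ops (snd x)
        \<le> length (y # zs) * (length b + length (y # zs)) * total_ops (snd x)"
      for x :: "int list \<times> pexp list list" and b and y :: val and zs :: "val list"
    proof -
      have "length zs * (length (grow (b, snd x)) + length zs) \<le> length zs * (Suc (length b) + length zs)"
        using length_grow[of b "snd x"] by (intro mult_le_mono) auto
      then have "length b + length zs * (length (grow (b, snd x)) + length zs)
          \<le> length (y # zs) * (length b + length (y # zs))" by simp
      then show ?thesis by (metis add_mult_distrib mult_le_mono1)
    qed
  qed
  then show ?thesis
    by (rule transforms_weaken) (auto simp: foldl_replicate_eq_funpow search_def)
qed

lemma transforms_decision:
  "transforms (int_points n \<times> lists (pexp_tuples n)) (\<lambda>(x, fs). encode_instance x fs)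
     (\<lambda>(x, fs). bool_val (\<forall>es\<in>set fs. pexp_map es ` set (search N fs x) = set (search N fs x)))
     (\<lambda>(x, fs). Suc N * Suc N * total_ops fs)"
proof -
  let ?A = "int_points n \<times> lists (pexp_tuples n)"
  let ?u = "\<lambda>(x, fs). encode_instance x fs"
  have 1: "transforms ?A ?u (\<lambda>(x, fs). encode_tuples fs) (\<lambda>_. 0)"
    by (rule transforms_expr[where e = "Snd (Var 0)"])
       (auto simp: encode_instance_def encode_tuples_def encode_tuple_def[abs_def])
  have 2: "transforms ?A (\<lambda>z. Pair ((\<lambda>(x, fs). encode_points (search N fs x)) z) ((\<lambda>(x, fs). encode_tuples fs) z))
      (\<lambda>(x, fs). bool_val (\<forall>es\<in>set fs. pexp_map es ` set (search N fs x) = set (search N fs x)))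
      (\<lambda>(x, fs). Suc N * total_ops fs)"
    by (rule transforms_call[OF transforms_permutation_check[of n], where h = "\<lambda>(x, fs). (search N fs x, fs)"
          and e = "Var 0"])
       (auto simp: lists_eq_set intro: search_states_search length_search simp del: mult_Suc)
  show ?thesis
    by (rule transforms_weaken[OF transforms_seq[OF transforms_pair[OF transforms_search 1] 2]])
       (auto simp: algebra_simps)
qed


section \<open>Correctness of the decision procedure\<close>

lemma orbit_subset_closed:
  assumes "x \<in> Y" "\<And>f. f \<in> S \<Longrightarrow> f ` Y \<subseteq> Y"
  shows "orbit S x \<subseteq> Y"
proof
  fix y assume "y \<in> orbit S x"
  then obtain g where g: "g \<in> generated_monoid S" "y = g x" using orbit_iff[of y S x] by metis
  have "g x \<in> Y"
    using g(1)
  proof (induction rule: generated_monoid.induct)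
    case (comp f g)
    then have "f (g x) \<in> f ` Y" by (intro imageI)
    then show ?case using assms(2)[OF comp.hyps(1)] by auto
  qed (simp add: assms(1))
  then show "y \<in> Y" by (simp add: g(2))
qed

lemma generator_in_generated_monoid: "f \<in> S \<Longrightarrow> f \<in> generated_monoid S"
  using generated_monoid.comp[OF _ generated_monoid.id, of f S] by simp

text \<open>
  If the generators map the finite set \<open>Y\<close> onto itself, then \<open>Y\<close> is closed and contains the orbit, and a
  surjection of a finite set onto itself is a bijection.
\<close>

lemma periodic_point_iff_permuted_set:
  assumes "finite Y" "x \<in> Y" "Y \<subseteq> orbit S x"
  shows "(\<forall>f\<in>S. f ` Y = Y) \<longleftrightarrow> periodic_point S x \<and> Y = orbit S x"
proof
  assume *: "\<forall>f\<in>S. f ` Y = Y"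
  then have Y: "Y = orbit S x"
    using orbit_subset_closed[OF assms(2), of S] assms(3) by (simp add: subset_antisym)
  have "bij_betw g Y Y" if "g \<in> generated_monoid S" for g
    using that
  proof (induction rule: generated_monoid.induct)
    case (comp f g)
    have "f ` Y = Y" using * comp.hyps(1) by blast
    then have "bij_betw f Y Y"
      using assms(1) by (simp add: bij_betw_def finite_surj_inj)
    with comp.IH show ?case by (rule bij_betw_trans)
  next
    case id
    show ?case by (rule bij_betw_id)
  qed
  then show "periodic_point S x \<and> Y = orbit S x"
    using assms(1) Y unfolding periodic_point_def by blast
next
  assume *: "periodic_point S x \<and> Y = orbit S x"
  show "\<forall>f\<in>S. f ` Y = Y"
  proof
    fix f assume "f \<in> S"
    then have "bij_betw f Y Y"
      using * generator_in_generated_monoid unfolding periodic_point_def by blast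
    then show "f ` Y = Y" by (simp add: bij_betw_def)
  qed
qed

text \<open>
  A round without a new point shows that the list is closed, and it then stays as it is; otherwise the
  list becomes longer by one.
\<close>

lemma search_invariant:
  "x \<in> set (search N fs x) \<and> distinct (search N fs x) \<and> set (search N fs x) \<subseteq> orbit (pexp_map ` set fs) x \<and>
   ((\<forall>es\<in>set fs. pexp_map es ` set (search N fs x) \<subseteq> set (search N fs x)) \<or> length (search N fs x) = Suc N)"
proof (induction N)
  case 0
  show ?case using self_in_orbit by (simp add: search_def)
next
  case (Suc N)
  let ?L = "search N fs x" and ?O = "orbit (pexp_map ` set fs) x"
  have next_def: "search (Suc N) fs x = grow (?L, fs)" by (simp add: search_def)
  have ne: "?L \<noteq> []" using Suc by auto
  show ?case
  proof (cases "candidate (?L, fs) \<in> set ?L")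
    case True
    then have "search (Suc N) fs x = ?L" by (simp add: next_def grow_def)
    then show ?thesis using Suc candidate_in_iff[OF ne, of fs] True by simp
  next
    case False
    then have new: "search (Suc N) fs x = candidate (?L, fs) # ?L" by (simp add: next_def grow_def)
    have len: "length ?L = Suc N" using Suc False candidate_in_iff[OF ne, of fs] by blast
    obtain es p where "es \<in> set fs" "p \<in> set ?L" "candidate (?L, fs) = pexp_map es p"
      using candidate_cases[OF ne, of fs] False by auto
    moreover have "pexp_map es p \<in> ?O" if "es \<in> set fs" "p \<in> set ?L" for es p
      by (rule orbit_closed[OF generator_in_generated_monoid]) (use that Suc in auto)
    ultimately have "candidate (?L, fs) \<in> ?O" by simp
    then show ?thesis using Suc len False by (simp add: new)
  qed
qed

text \<open>
  By the bound, the orbit of a periodic point cannot contain the \<open>N + 1\<close> distinct points of a list that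
  has grown in every round.
\<close>

lemma periodic_point_iff_search:
  assumes "x \<in> int_points n" "set fs \<subseteq> pexp_tuples n"
  shows "periodic_point (pexp_map ` set fs) x \<longleftrightarrow>
    (\<forall>es\<in>set fs. pexp_map es ` set (search (9 ^ (Suc n * n)) fs x) = set (search (9 ^ (Suc n * n)) fs x))"
proof -
  let ?N = "9 ^ (Suc n * n)" and ?S = "pexp_map ` set fs"
  let ?L = "search ?N fs x"
  have inv: "x \<in> set ?L" "distinct ?L" "set ?L \<subseteq> orbit ?S x"
    "(\<forall>es\<in>set fs. pexp_map es ` set ?L \<subseteq> set ?L) \<or> length ?L = Suc ?N"
    using search_invariant[of x ?N fs] by blast+
  have iff: "(\<forall>es\<in>set fs. pexp_map es ` set ?L = set ?L) \<longleftrightarrow> periodic_point ?S x \<and> set ?L = orbit ?S x"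
    using periodic_point_iff_permuted_set[OF _ inv(1,3)] by simp
  have "set ?L = orbit ?S x" if per: "periodic_point ?S x"
  proof -
    have "\<forall>F\<in>?S. polynomial_map n F" using assms(2) polynomial_map_pexp_map by blast
    then have "card (orbit ?S x) \<le> ?N" using card_orbit_le assms(1) per by blast
    moreover have "card (set ?L) \<le> card (orbit ?S x)"
      using per inv(3) by (intro card_mono) (auto simp: periodic_point_def)
    ultimately have "length ?L \<noteq> Suc ?N" using distinct_card[OF inv(2)] by simp
    then have "\<forall>es\<in>set fs. pexp_map es ` set ?L \<subseteq> set ?L" using inv(4) by blast
    then have "orbit ?S x \<subseteq> set ?L" by (intro orbit_subset_closed[OF inv(1)]) auto
    then show ?thesis using inv(3) by blast
  qed
  then show ?thesis using iff by blast
qed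

lemma ex_decides_periodicity: "\<exists>c. \<exists>q :: nat poly. decides_periodicity n c (poly q)"
proof -
  let ?N = "9 ^ (Suc n * n)"
  obtain c where c: "\<forall>z\<in>int_points n \<times> lists (pexp_tuples n).
      \<exists>k\<le>(\<lambda>(x, fs). Suc ?N * Suc ?N * total_ops fs) z.
        computes c ((\<lambda>(x, fs). encode_instance x fs) z) k
          ((\<lambda>(x, fs). bool_val (\<forall>es\<in>set fs. pexp_map es ` set (search ?N fs x) = set (search ?N fs x))) z)"
    using transforms_computes[OF transforms_decision[of n ?N]] by (elim exE)
  have "decides_periodicity n c (poly [:0, Suc ?N * Suc ?N:])"
    unfolding decides_periodicity_def
  proof (intro ballI)
    fix x fs assume x: "x \<in> int_points n" and fs: "fs \<in> lists (pexp_tuples n)"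
    have "set fs \<subseteq> pexp_tuples n" using fs by auto
    from periodic_point_iff_search[OF x this] bspec[OF c, of "(x, fs)"] x fs
    show "\<exists>k\<le>poly [:0, Suc ?N * Suc ?N:] (total_ops fs). computes c (encode_instance x fs) k
        (IntV (if periodic_point (pexp_map ` set fs) x then 1 else 0))"
      by (simp add: bool_val_def mult.commute del: mult_Suc mult_Suc_right power_Suc)
  qed
  then show ?thesis by blast
qed

section \<open>Computing the bound\<close>

lemma effective_orbit_bound: "effective (\<lambda>n. 9 ^ (Suc n * n))"
proof -
  let ?u = "\<lambda>(i, m). Pair (IntV (9 ^ i)) (Pair (IntV (int i)) (IntV (int m)))"
  have "transforms {(i, m). i \<le> m} ?u (\<lambda>(i, m). ?u (m, m)) (\<lambda>(i, m). 2 * (m - i))"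
  proof (rule transforms_while[where b = "LessInt (Fst (Snd (Var 0))) (Snd (Snd (Var 0)))"
        and P = "\<lambda>(i, m). i < m" and f = "\<lambda>(i, m). (Suc i, m)" and m = "\<lambda>(i, m). m - i"])
    show "transforms {x \<in> {(i, m). i \<le> m}. (\<lambda>(i, m). i < m) x} ?u
        (\<lambda>x. ?u ((\<lambda>(i, m). (Suc i, m)) x)) (\<lambda>_. 2)"
      by (rule transforms_expr[where e = "PairE (Times (Fst (Var 0)) (Lit 9))
            (PairE (Plus (Fst (Snd (Var 0))) (Lit 1)) (Snd (Snd (Var 0))))"]) auto
  qed auto
  then have loop: "transforms UNIV (\<lambda>n. ?u (0, Suc n * n)) (\<lambda>n. ?u (Suc n * n, Suc n * n))
      (\<lambda>n. 2 * (Suc n * n))"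
    by (rule transforms_reindex[where h = "\<lambda>n. (0, Suc n * n)"]) auto
  have start: "transforms UNIV (\<lambda>n. IntV (int n)) (\<lambda>n. ?u (0, Suc n * n)) (\<lambda>_. 2)"
    by (rule transforms_expr[where e = "PairE (Lit 1) (PairE (Lit 0) (Times (Plus (Lit 1) (Var 0)) (Var 0)))"])
       (auto simp: algebra_simps)
  have stop: "transforms UNIV (\<lambda>n. ?u (Suc n * n, Suc n * n)) (\<lambda>n. IntV (int (9 ^ (Suc n * n)))) (\<lambda>_. 0)"
    by (rule transforms_expr[where e = "Fst (Var 0)"]) auto
  from transforms_computes[OF transforms_seq[OF start transforms_seq[OF loop stop]]]
  show ?thesis unfolding effective_def by blast
qed

theorem theorem1p1:
  shows "(\<exists>C. effective C \<and>
            (\<forall>n\<ge>1. \<forall>S. (\<forall>F \<in> S. polynomial_map n F) \<longrightarrow>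
               (\<forall>x \<in> int_points n. periodic_point S x \<longrightarrow> card (orbit S x) \<le> C n)))
       \<and> (\<forall>n\<ge>1. \<exists>c. \<exists>q :: nat poly. decides_periodicity n c (poly q))"
  using effective_orbit_bound card_orbit_le ex_decides_periodicity by blast

end
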